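(* Let $m\ge1$, and let ${}^m\mathbf{FQSym}^*$ be the linear span of the $\mathbf{G}_\alpha$ for $\alpha\in\mathfrak{S}_n^{(m)}$, $n\ge0$. Then ${}^m\mathbf{FQSym}^*$ is a Hopf subalgebra of $\mathbf{WQSym}$, whose product and coproduct are given by $$\mathbf{G}_\alpha\mathbf{G}_\beta=\sum_{\gamma\in\alpha\star_m\beta}\mathbf{G}_\gamma,\qquad \Delta\mathbf{G}_\alpha=\sum_{k=0}^n\mathbf{G}_{\mathrm{std}_m(\alpha[1..k])}\otimes\mathbf{G}_{\mathrm{std}_m(\alpha[k+1..n])}\quad(\alpha\in\mathfrak{S}_n^{(m)}),$$ where $\alpha\star_m\beta$ is the set of $m$-permutations $\gamma=uv$ such that $\mathrm{std}_m(u)=\alpha$ and $\mathrm{std}_m(v)=\beta$, and $\alpha[i..j]$ denotes the subword of $\alpha$ formed by the letters belonging to the interval $[i,j]$.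
   Context: $\mathbb{K}$ is a field of characteristic $0$; $A=\{1<2<\cdots\}$ is an infinite totally ordered alphabet, and $\mathbb{K}\langle A\rangle$ denotes the inverse limit (in the category of graded algebras) of the free associative algebras over finite subsets of $A$. $\mathfrak{S}_n^{(m)}$ is the set of $m$-permutations of $n$, i.e. words over $\{1,\dots,n\}$ in which each letter occurs exactly $m$ times. An $m$-word is a word in which the number of occurrences of each letter is a multiple of $m$. The $m$-standardization $\mathrm{std}_m(w)\in\mathfrak{S}_n^{(m)}$ of an $m$-word $w$ of length $mn$ is obtained by iteratively scanning $w$ from left to right, labelling $1$ the first $m$ occurrences of the smallest letter, then $2$ the next $m$ occurrences of this letter or, if there are none left, the first $m$ occurrences of the next letter, and so on. For $\alpha\in\mathfrak{S}_n^{(m)}$, $\mathbf{G}_\alpha=\sum w$, sum over $m$-words $w$ of length $mn$ with $\mathrm{std}_m(w)=\alpha$. If $b_1<\cdots<b_r$ are the letters occurring in $w$, $\mathrm{pack}(w)$ is the image of $w$ under $b_i\mapsto i$; $u$ is packed if $\mathrm{pack}(u)=u$. $\mathbf{WQSym}$ is the Hopf algebra with basis $\mathbf{M}_u=\sum_{\mathrm{pack}(w)=u}w$, $u$ packed; it is a subalgebra of $\mathbb{K}\langle A\rangle$ with product $\mathbf{M}_{u'}\mathbf{M}_{u''}=\sum\mathbf{M}_u$ over packed words $u=v\cdot w$ with $\mathrm{pack}(v)=u'$, $\mathrm{pack}(w)=u''$, and coproduct $\Delta\mathbf{M}_u=\sum_{0\le k\le\max(u)}\mathbf{M}_{u|_{[1,k]}}\otimes\mathbf{M}_{\mathrm{pack}(u|_{[k+1,\max(u)]})}$,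 where $u|_B$ is the subword of letters of $u$ in $B$. *)

theory Defs
  imports Complex_Main "HOL-Library.Function_Algebras"
begin

section \<open>Noncommutative series over the alphabet 1 < 2 < 3 < ...\<close>

text \<open>A word is a list of positive naturals, and a noncommutative series is its coefficient
  function on words. Addition and zero of series are pointwise (\<^theory>\<open>HOL-Library.Function_Algebras\<close>);
  the pointwise product from that theory is never used, the product being \<open>mult\<close> below.\<close>

type_synonym 'k series = "nat list \<Rightarrow> 'k"

text \<open>Series in two sets of words. The tensor product of two spaces of series embeds into these
  by \<open>(f \<otimes> g) (v, w) = f v * g w\<close>, which is injective because the coefficients form a field.\<close>

type_synonym 'k series2 = "nat list \<times> nat list \<Rightarrow> 'k"

definition fscale :: "'k \<Rightarrow> ('a \<Rightarrow> 'k) \<Rightarrow> 'a \<Rightarrow> 'k::field" where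
  "fscale c f = (\<lambda>x. c * f x)"

global_interpretation fun_space: vector_space "fscale :: 'k \<Rightarrow> ('a \<Rightarrow> 'k) \<Rightarrow> 'a \<Rightarrow> 'k::field"
  by unfold_locales (auto simp: fscale_def fun_eq_iff algebra_simps)

definition is_word :: "nat list \<Rightarrow> bool" where
  "is_word w \<longleftrightarrow> (\<forall>a\<in>set w. 1 \<le> a)"

text \<open>The inverse limit of the free associative algebras over the finite subalphabets is taken
  among graded algebras, so its elements are the series of bounded degree.\<close>

definition free_algebra :: "'k::field series set" where
  "free_algebra = {f. (\<forall>w. f w \<noteq> 0 \<longrightarrow> is_word w) \<and> (\<exists>d. \<forall>w. f w \<noteq> 0 \<longrightarrow> length w \<le> d)}"

definition tens :: "'k::field series \<Rightarrow> 'k series \<Rightarrow> 'k series2" where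
  "tens f g = (\<lambda>(v, w). f v * g w)"

definition tensor_space :: "'k::field series set \<Rightarrow> 'k series set \<Rightarrow> 'k series2 set" where
  "tensor_space U V = fun_space.span {tens f g | f g. f \<in> U \<and> g \<in> V}"

text \<open>The concatenation product, first as a map on the tensor square.\<close>

definition mult2 :: "'k::field series2 \<Rightarrow> 'k series" where
  "mult2 t = (\<lambda>w. \<Sum>i\<le>length w. t (take i w, drop i w))"

definition mult :: "'k::field series \<Rightarrow> 'k series \<Rightarrow> 'k series" where
  "mult f g = mult2 (tens f g)"

definition unit_series :: "'k::field series" where
  "unit_series = (\<lambda>w. if w = [] then 1 else 0)"

section \<open>WQSym\<close>

definition pack :: "nat list \<Rightarrow> nat list" where
  "pack w = map (\<lambda>b. card {a \<in> set w. a \<le> b}) w"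

definition packed :: "nat list \<Rightarrow> bool" where
  "packed u \<longleftrightarrow> pack u = u"

definition max_letter :: "nat list \<Rightarrow> nat" where
  "max_letter u = Max (insert 0 (set u))"

definition restr :: "nat list \<Rightarrow> nat set \<Rightarrow> nat list" where
  "restr u B = filter (\<lambda>a. a \<in> B) u"

definition M :: "nat list \<Rightarrow> 'k::field series" where
  "M u = (\<lambda>w. if is_word w \<and> pack w = u then 1 else 0)"

definition WQSym :: "'k::field series set" where
  "WQSym = fun_space.span {M u | u. packed u}"

text \<open>For packed \<open>u\<close> and \<open>v\<close>, the coefficient of \<open>v\<close> in \<open>M u\<close> is 1 if \<open>u = v\<close> and 0 otherwise, so
  the coordinates of \<open>f \<in> WQSym\<close> in the basis \<open>M\<close> are the numbers \<open>f u\<close>, \<open>u\<close> packed. Hence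
  \<open>lin_ext packed b\<close> is on \<open>WQSym\<close> the linear map with \<open>M u \<mapsto> b u\<close>, and likewise for the tensor
  square; see the lemmas below. The values outside these spaces have no meaning.\<close>

definition lin_ext :: "('i \<Rightarrow> bool) \<Rightarrow> ('i \<Rightarrow> 'a \<Rightarrow> 'k) \<Rightarrow> ('i \<Rightarrow> 'k) \<Rightarrow> 'a \<Rightarrow> 'k::field" where
  "lin_ext P b f = (\<Sum>i\<in>{i. P i \<and> f i \<noteq> 0}. fscale (f i) (b i))"

definition Delta_basis :: "nat list \<Rightarrow> 'k::field series2" where
  "Delta_basis u = (\<Sum>k = 0..max_letter u.
     tens (M (restr u {1..k})) (M (pack (restr u {k + 1..max_letter u}))))"

definition Delta :: "'k::field series \<Rightarrow> 'k series2" where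
  "Delta = lin_ext packed Delta_basis"

text \<open>The counit, \<open>M u \<mapsto> (if u = [] then 1 else 0)\<close>.\<close>

definition counit :: "'k::field series \<Rightarrow> 'k" where
  "counit f = f []"

definition linear_on_WQSym :: "('k::field series \<Rightarrow> 'k series) \<Rightarrow> bool" where
  "linear_on_WQSym S \<longleftrightarrow>
     (\<forall>f\<in>WQSym. \<forall>g\<in>WQSym. S (f + g) = S f + S g) \<and> (\<forall>c. \<forall>f\<in>WQSym. S (fscale c f) = fscale c (S f))"

text \<open>The map \<open>S \<otimes> T\<close> on the tensor square of \<open>WQSym\<close>, and the convolution product.\<close>

definition tensor_map ::
  "('k::field series \<Rightarrow> 'k series) \<Rightarrow> ('k series \<Rightarrow> 'k series) \<Rightarrow> 'k series2 \<Rightarrow> 'k series2" where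
  "tensor_map S T =
     lin_ext (\<lambda>(u, v). packed u \<and> packed v) (\<lambda>(u, v). tens (S (M u)) (T (M v)))"

definition convolution ::
  "('k::field series \<Rightarrow> 'k series) \<Rightarrow> ('k series \<Rightarrow> 'k series) \<Rightarrow> 'k series \<Rightarrow> 'k series" where
  "convolution S T f = mult2 (tensor_map S T (Delta f))"

definition is_antipode :: "('k::field series \<Rightarrow> 'k series) \<Rightarrow> bool" where
  "is_antipode S \<longleftrightarrow> linear_on_WQSym S \<and> S ` WQSym \<subseteq> WQSym \<and>
     (\<forall>f\<in>WQSym. convolution S id f = fscale (counit f) unit_series \<and>
                convolution id S f = fscale (counit f) unit_series)"

text \<open>As a map on \<open>WQSym\<close> the antipode is unique. The last two conjuncts say that \<open>WQSym\<close> has an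
  antipode and that it maps \<open>H\<close> into itself.\<close>

definition hopf_subalgebra_of_WQSym :: "'k::field series set \<Rightarrow> bool" where
  "hopf_subalgebra_of_WQSym H \<longleftrightarrow>
     fun_space.subspace H \<and> H \<subseteq> WQSym \<and>
     unit_series \<in> H \<and> (\<forall>f\<in>H. \<forall>g\<in>H. mult f g \<in> H) \<and>
     Delta ` H \<subseteq> tensor_space H H \<and>
     (\<exists>S :: 'k series \<Rightarrow> 'k series. is_antipode S) \<and>
     (\<forall>S :: 'k series \<Rightarrow> 'k series. is_antipode S \<longrightarrow> S ` H \<subseteq> H)"

section \<open>m-permutations and m-standardization\<close>

definition m_perms :: "nat \<Rightarrow> nat \<Rightarrow> nat list set" where
  "m_perms m n = {w. set w \<subseteq> {1..n} \<and> (\<forall>i\<in>{1..n}. count_list w i = m)}"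

definition m_word :: "nat \<Rightarrow> nat list \<Rightarrow> bool" where
  "m_word m w \<longleftrightarrow> is_word w \<and> (\<forall>a. m dvd count_list w a)"

text \<open>The set of positions of \<open>w\<close> (counted from 0) still without label after the labels \<open>1, ..., j\<close>
  have been distributed. The label \<open>j + 1\<close> goes to the first \<open>m\<close> unlabelled occurrences of the
  smallest letter that still has unlabelled occurrences.\<close>

primrec unlabelled :: "nat \<Rightarrow> nat list \<Rightarrow> nat \<Rightarrow> nat set" where
  "unlabelled m w 0 = {..<length w}"
| "unlabelled m w (Suc j) =
     (let U = unlabelled m w j; a = Min ((!) w ` U)
      in U - set (take m (filter (\<lambda>i. i \<in> U \<and> w ! i = a) [0..<length w])))"

definition std :: "nat \<Rightarrow> nat list \<Rightarrow> nat list" where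
  "std m w = map (\<lambda>i. LEAST j. i \<notin> unlabelled m w j) [0..<length w]"

definition G :: "nat \<Rightarrow> nat list \<Rightarrow> 'k::field series" where
  "G m \<alpha> = (\<lambda>w. if m_word m w \<and> std m w = \<alpha> then 1 else 0)"

definition mFQSym_dual :: "nat \<Rightarrow> 'k::field series set" where
  "mFQSym_dual m = fun_space.span {G m \<alpha> | \<alpha> n. \<alpha> \<in> m_perms m n}"

text \<open>\<open>std m\<close> is only meaningful on m-words, hence the conditions on \<open>u\<close> and \<open>v\<close>.\<close>

definition star :: "nat \<Rightarrow> nat list \<Rightarrow> nat list \<Rightarrow> nat list set" where
  "star m \<alpha> \<beta> = {\<gamma>. (\<exists>n. \<gamma> \<in> m_perms m n) \<and>
     (\<exists>u v. \<gamma> = u @ v \<and> m_word m u \<and> m_word m v \<and> std m u = \<alpha> \<and> std m v = \<beta>)}"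

section \<open>Justification of the encodings\<close>

lemma packed_imp_is_word: "packed u \<Longrightarrow> is_word u"
proof -
  assume u: "packed u"
  have "1 \<le> a" if "a \<in> set u" for a
  proof -
    from that u have "a \<in> set (pack u)" by (simp add: packed_def)
    then obtain b where b: "b \<in> set u" "a = card {c \<in> set u. c \<le> b}"
      by (auto simp: pack_def)
    then have "{c \<in> set u. c \<le> b} \<noteq> {}" by blast
    then show ?thesis using b(2) by (simp add: Suc_leI card_gt_0_iff)
  qed
  then show ?thesis by (simp add: is_word_def)
qed

lemma M_packed: "packed u \<Longrightarrow> packed v \<Longrightarrow> M u v = (if u = v then 1 else 0)"
  by (auto simp: M_def packed_imp_is_word packed_def)

lemma M_in_WQSym: "packed u \<Longrightarrow> M u \<in> WQSym"
  unfolding WQSym_def by (rule fun_space.span_base) blast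

lemma WQSym_subset_free_algebra: "(WQSym :: 'k::field series set) \<subseteq> free_algebra"
  unfolding WQSym_def
proof (rule fun_space.span_minimal)
  show "{M u | u. packed u} \<subseteq> (free_algebra :: 'k series set)"
  proof clarify
    fix u
    show "(M u :: 'k series) \<in> free_algebra"
      unfolding free_algebra_def M_def pack_def by (auto intro!: exI[of _ "length u"] split: if_splits)
  qed
  show "fun_space.subspace (free_algebra :: 'k series set)"
  proof (rule fun_space.subspaceI)
    show "0 \<in> (free_algebra :: 'k series set)" by (simp add: free_algebra_def)
  next
    fix f g :: "'k series" assume "f \<in> free_algebra" "g \<in> free_algebra"
    then obtain d e where fg: "\<And>w. f w \<noteq> 0 \<Longrightarrow> is_word w \<and> length w \<le> d"
      "\<And>w. g w \<noteq> 0 \<Longrightarrow> is_word w \<and> length w \<le> e"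
      unfolding free_algebra_def by blast
    have "is_word w \<and> length w \<le> max d e" if "(f + g) w \<noteq> 0" for w
      using that fg(1)[of w] fg(2)[of w] by (cases "f w = 0") (auto simp: le_max_iff_disj)
    then show "f + g \<in> free_algebra" unfolding free_algebra_def by blast
  next
    fix c and f :: "'k series" assume "f \<in> free_algebra"
    then show "fscale c f \<in> free_algebra" by (auto simp: free_algebra_def fscale_def)
  qed
qed

lemma finite_packed_support:
  assumes "f \<in> WQSym" shows "finite {u. packed u \<and> f u \<noteq> 0}"
  using assms unfolding WQSym_def
proof (induction rule: fun_space.span_induct_alt)
  case base
  then show ?case by simp
next
  case (step c x y)
  then obtain u where u: "packed u" "x = M u" by blast
  have "{v. packed v \<and> (fscale c x + y) v \<noteq> 0} \<subseteq> insert u {v. packed v \<and> y v \<noteq> 0}"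
    using u by (auto simp: M_packed fscale_def split: if_splits)
  then show ?case using step.IH by (auto intro: finite_subset)
qed

lemma lin_ext_superset:
  assumes "finite A" "\<And>i. i \<in> A \<Longrightarrow> P i" "{i. P i \<and> f i \<noteq> 0} \<subseteq> A"
  shows "lin_ext P b f = (\<Sum>i\<in>A. fscale (f i) (b i))"
  unfolding lin_ext_def
proof (rule sum.mono_neutral_left[OF assms(1,3)], rule ballI)
  fix i assume "i \<in> A - {i. P i \<and> f i \<noteq> 0}"
  then have "f i = 0" using assms(2) by blast
  then show "fscale (f i) (b i) = 0" by (simp add: fscale_def fun_eq_iff)
qed

lemma lin_ext_M:
  assumes "packed u" shows "lin_ext packed b (M u) = b u"
  by (subst lin_ext_superset[of "{u}"])
    (use assms in \<open>auto simp: M_packed fscale_def split: if_splits\<close>)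

lemma lin_ext_add:
  assumes "f \<in> WQSym" "g \<in> WQSym"
  shows "lin_ext packed b (f + g) = lin_ext packed b f + lin_ext packed b g"
proof -
  let ?A = "{u. packed u \<and> f u \<noteq> 0} \<union> {u. packed u \<and> g u \<noteq> 0}"
  have fin: "finite ?A" using assms by (simp add: finite_packed_support)
  have "lin_ext packed b h = (\<Sum>i\<in>?A. fscale (h i) (b i))" if "h \<in> {f, g, f + g}" for h
    by (rule lin_ext_superset[OF fin]) (use that in auto)
  then show ?thesis by (simp add: sum.distrib[symmetric] fun_space.scale_left_distrib)
qed

lemma lin_ext_scale:
  assumes "f \<in> WQSym"
  shows "lin_ext packed b (fscale c f) = fscale c (lin_ext packed b f)"
proof -
  let ?A = "{u. packed u \<and> f u \<noteq> 0}"
  have fin: "finite ?A" using assms by (simp add: finite_packed_support)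
  have "lin_ext packed b h = (\<Sum>i\<in>?A. fscale (h i) (b i))" if "h \<in> {f, fscale c f}" for h
    by (rule lin_ext_superset[OF fin]) (use that in \<open>auto simp: fscale_def\<close>)
  then show ?thesis
    by (simp add: fun_space.scale_sum_right) (simp add: fscale_def mult.assoc)
qed

lemma Delta_M: "packed u \<Longrightarrow> Delta (M u) = Delta_basis u"
  by (simp add: Delta_def lin_ext_M)

lemma Delta_add: "f \<in> WQSym \<Longrightarrow> g \<in> WQSym \<Longrightarrow> Delta (f + g) = Delta f + Delta g"
  by (simp add: Delta_def lin_ext_add)

lemma Delta_scale: "f \<in> WQSym \<Longrightarrow> Delta (fscale c f) = fscale c (Delta f)"
  by (simp add: Delta_def lin_ext_scale)

lemma linear_on_WQSym_expand:
  fixes S :: "'k::field series \<Rightarrow> 'k series"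
  assumes S: "linear_on_WQSym S" and f: "f \<in> WQSym"
  shows "S f = lin_ext packed (\<lambda>u. S (M u)) f"
proof -
  have "f \<in> WQSym \<and> S f = lin_ext packed (\<lambda>u. S (M u)) f"
    using f[unfolded WQSym_def]
  proof (induction rule: fun_space.span_induct_alt)
    case base
    have mem: "0 \<in> (WQSym :: 'k series set)" by (simp add: WQSym_def fun_space.span_zero)
    then have "S (fscale 0 0) = fscale 0 (S 0)" using S unfolding linear_on_WQSym_def by blast
    with mem show ?case by (simp add: lin_ext_def zero_fun_def)
  next
    case (step c x y)
    then obtain u where u: "packed u" "x = M u" by blast
    have mem: "x \<in> WQSym" "fscale c x \<in> WQSym" "y \<in> WQSym" "fscale c x + y \<in> WQSym"
      using u step.IH M_in_WQSym[OF u(1)]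
      by (auto simp: WQSym_def intro: fun_space.span_scale fun_space.span_add)
    have "S (fscale c x + y) = fscale c (S x) + S y"
      using S mem by (simp add: linear_on_WQSym_def)
    also have "\<dots> = lin_ext packed (\<lambda>u. S (M u)) (fscale c x + y)"
      using step.IH mem by (simp only: lin_ext_add lin_ext_scale) (simp add: u lin_ext_M)
    finally show ?case using mem(4) by (intro conjI)
  qed
  then show ?thesis ..
qed

lemma tensor_map_tens:
  assumes "linear_on_WQSym S" "linear_on_WQSym T" "f \<in> WQSym" "g \<in> WQSym"
  shows "tensor_map S T (tens f g) = tens (S f) (T g)"
proof -
  let ?A = "{u. packed u \<and> f u \<noteq> 0}" and ?B = "{u. packed u \<and> g u \<noteq> 0}"
  have eval: "(\<Sum>i\<in>I. h i) x = (\<Sum>i\<in>I. h i x)"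
    for I :: "'i set" and h :: "'i \<Rightarrow> 'y \<Rightarrow> 'a" and x
    by (induction I rule: infinite_finite_induct) auto
  have "{(u, v). (packed u \<and> packed v) \<and> tens f g (u, v) \<noteq> 0} = ?A \<times> ?B"
    by (auto simp: tens_def)
  note supp = this
  have "tensor_map S T (tens f g) (x, y) = tens (S f) (T g) (x, y)" for x y
  proof -
    have "tensor_map S T (tens f g) (x, y) =
        (\<Sum>(u, v)\<in>?A \<times> ?B. f u * g v * (S (M u) x * T (M v) y))"
      using supp by (simp add: tensor_map_def lin_ext_def eval case_prod_unfold tens_def fscale_def)
    also have "\<dots> = (\<Sum>u\<in>?A. f u * S (M u) x) * (\<Sum>v\<in>?B. g v * T (M v) y)"
      by (simp add: sum_product sum.cartesian_product mult_ac)
    also have "\<dots> = tens (S f) (T g) (x, y)"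
      using linear_on_WQSym_expand[OF assms(1,3)] linear_on_WQSym_expand[OF assms(2,4)]
      by (simp add: tens_def lin_ext_def eval fscale_def)
    finally show ?thesis .
  qed
  then show ?thesis by (auto simp: fun_eq_iff)
qed

end

theory Submission
  imports Defs
begin

text \<open>List the positions of an m-word \<open>w\<close> by letter, and from left to right for equal letters. Since
  every letter occurs a multiple of \<open>m\<close> times, the label of a position under \<open>std m\<close> is its rank in
  this list divided by \<open>m\<close>. Hence \<open>std m w\<close> is a complete invariant of the relative order of the
  positions, which restricts well to factors and to subwords on intervals of letters, and is
  invariant under packing.

  Both \<open>WQSym\<close> and \<open>mFQSym_dual m\<close> consist of the series of bounded degree that are supported
  on a class of words and invariant under a normalization map (\<open>pack\<close> and \<open>std m\<close>), and cutting a
  word in two is compatible with both maps; this gives the product. For the coproduct, the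
  coefficient of a pair \<open>(v, w)\<close> in \<open>Delta (G m \<alpha>)\<close> counts the packed words with m-standardization \<open>\<alpha>\<close>
  that cut into the packings of \<open>v\<close> and \<open>w\<close>. Such a word is a shuffle of \<open>pack v\<close> with a shift of
  \<open>pack w\<close>, along the positions of the letters of \<open>\<alpha>\<close> up to \<open>length v div m\<close>, so there is at most one.

  The antipode of \<open>WQSym\<close> is defined by recursion on the largest letter, and the antipode axiom for
  \<open>G m \<alpha>\<close> expresses the image of \<open>G m \<alpha>\<close> through those of smaller degree, so that the antipode
  preserves \<open>mFQSym_dual m\<close> by induction on the degree.\<close>

section \<open>m-standardization as a ranking\<close>

definition precedes :: "nat list \<Rightarrow> nat \<Rightarrow> nat \<Rightarrow> bool" where
  "precedes w i j \<longleftrightarrow> w ! i < w ! j \<or> (w ! i = w ! j \<and> i < j)"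

definition rank :: "nat list \<Rightarrow> nat \<Rightarrow> nat" where
  "rank w i = card {j. j < length w \<and> precedes w j i}"

text \<open>For \<open>i < j\<close> the weak comparison separates inversions from all other pairs,
  so equivalent words are those with the same inversions. Equal letters count like ascending ones,
  which lets a word be equivalent to its standardization although the latter may give them different
  labels.\<close>

definition order_equiv :: "nat list \<Rightarrow> nat list \<Rightarrow> bool" where
  "order_equiv v w \<longleftrightarrow> length v = length w \<and>
     (\<forall>i j. i < j \<longrightarrow> j < length w \<longrightarrow> (v ! i \<le> v ! j \<longleftrightarrow> w ! i \<le> w ! j))"

lemma precedes_trans: "precedes w i j \<Longrightarrow> precedes w j k \<Longrightarrow> precedes w i k"
  by (auto simp: precedes_def)

lemma precedes_irrefl [simp]: "\<not> precedes w i i"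
  by (auto simp: precedes_def)

lemma precedes_total: "i \<noteq> j \<Longrightarrow> precedes w i j \<or> precedes w j i"
  by (auto simp: precedes_def)

text \<open>\<open>D\<close> is an initial segment of the total order \<open>precedes w\<close>. A
  position outside \<open>D\<close> comes after all of \<open>D\<close>, while the predecessors of a
  member form a proper subset of \<open>D\<close>.\<close>

lemma rank_less_card_iff:
  assumes D: "D \<subseteq> {..<length w}" and down: "\<And>i j. i \<in> D \<Longrightarrow> j < length w \<Longrightarrow> precedes w j i \<Longrightarrow> j \<in> D"
    and i: "i < length w"
  shows "rank w i < card D \<longleftrightarrow> i \<in> D"
proof
  have fin: "finite D" using D finite_subset by blast
  show "i \<in> D" if "rank w i < card D"
  proof (rule ccontr)
    assume "i \<notin> D"
    have "precedes w j i" if "j \<in> D" for j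
      using down[OF that i] precedes_total[of i j w] \<open>i \<notin> D\<close> that by blast
    then have "D \<subseteq> {j. j < length w \<and> precedes w j i}" using D by blast
    then have "card D \<le> rank w i" unfolding rank_def by (intro card_mono) auto
    with that show False by simp
  qed
  show "rank w i < card D" if "i \<in> D"
    unfolding rank_def using that down by (intro psubset_card_mono fin) fastforce
qed

lemma rank_less_iff:
  assumes "i < length w" "j < length w"
  shows "rank w i < rank w j \<longleftrightarrow> precedes w i j"
  using rank_less_card_iff[of "{l. l < length w \<and> precedes w l j}" w i] assms precedes_trans
  unfolding rank_def[of w j] by auto

lemma rank_less_length: "i < length w \<Longrightarrow> rank w i < length w"
  using rank_less_card_iff[of "{..<length w}" w i] by simp

lemma inj_on_rank: "inj_on (rank w) {..<length w}"
  using rank_less_iff precedes_total by (metis inj_onI lessThan_iff less_irrefl)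

lemma rank_image: "rank w ` {..<length w} = {..<length w}"
  by (rule endo_inj_surj) (auto simp: rank_less_length inj_on_rank)

lemma card_rank_less:
  assumes "n \<le> length w"
  shows "card {i. i < length w \<and> rank w i < n} = n"
proof -
  have "rank w ` {i. i < length w \<and> rank w i < n} = {..<n}"
  proof (intro equalityI subsetI)
    fix k assume "k \<in> {..<n}"
    then have "k \<in> rank w ` {..<length w}" using assms by (simp add: rank_image)
    then show "k \<in> rank w ` {i. i < length w \<and> rank w i < n}" using \<open>k \<in> {..<n}\<close> by auto
  qed auto
  moreover have "inj_on (rank w) {i. i < length w \<and> rank w i < n}"
    by (rule inj_on_subset[OF inj_on_rank]) auto
  ultimately show ?thesis by (metis card_image card_lessThan)
qed

section \<open>Label classes in m-words\<close>

lemma count_list_card: "count_list w a = card {i. i < length w \<and> w ! i = a}"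
  by (simp add: count_list_eq_length_filter length_filter_conv_card eq_commute)

text \<open>The positions split into one class per letter satisfying \<open>P\<close>. The bound
  \<open>n\<close> is independent of \<open>length w\<close>, so that prefixes are covered as
  well.\<close>

lemma dvd_card_positions:
  assumes "\<And>a. m dvd card {i. i < n \<and> w ! i = a}"
  shows "m dvd card {i. i < n \<and> P (w ! i :: nat)}"
proof -
  have "{i. i < n \<and> P (w ! i)} = (\<Union>a\<in>{a \<in> (!) w ` {..<n}. P a}. {i. i < n \<and> w ! i = a})"
    by auto
  moreover have "card \<dots> = (\<Sum>a\<in>{a \<in> (!) w ` {..<n}. P a}. card {i. i < n \<and> w ! i = a})"
    by (rule card_UN_disjoint) auto
  ultimately show ?thesis using assms by (simp add: dvd_sum)
qed

lemma m_word_dvd_card: "m_word m w \<Longrightarrow> m dvd card {i. i < length w \<and> P (w ! i)}"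
  by (rule dvd_card_positions) (simp add: m_word_def flip: count_list_card)

lemma m_word_dvd_length: "m_word m w \<Longrightarrow> m dvd length w"
  using m_word_dvd_card[of m w "\<lambda>_. True"] by simp

text \<open>An initial segment whose size is a multiple of \<open>m\<close> remains visible after
  ranks are divided by \<open>m\<close>, that is, on labels.\<close>

lemma rank_div_less_iff:
  assumes "m \<ge> 1" and D: "D \<subseteq> {..<length w}" "\<And>i j. i \<in> D \<Longrightarrow> j < length w \<Longrightarrow> precedes w j i \<Longrightarrow> j \<in> D"
    and i: "i < length w" and dvd: "m dvd card D"
  shows "rank w i div m < card D div m \<longleftrightarrow> i \<in> D"
  using rank_less_card_iff[OF D i] assms(1) dvd by (simp add: div_less_iff_less_mult)

text \<open>The positions with letters below \<open>b\<close> form an initial segment of size a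
  multiple of \<open>m\<close>, so no label straddles its boundary.\<close>

lemma rank_div_less_letter_iff:
  assumes "m \<ge> 1" "m_word m w" "i < length w"
  shows "rank w i div m < card {l. l < length w \<and> w ! l < b} div m \<longleftrightarrow> w ! i < b"
proof -
  have "rank w i div m < card {l. l < length w \<and> w ! l < b} div m \<longleftrightarrow> i \<in> {l. l < length w \<and> w ! l < b}"
    by (rule rank_div_less_iff[OF assms(1)])
      (use assms m_word_dvd_card[OF assms(2), of "\<lambda>x. x < b"] in \<open>auto simp: precedes_def\<close>)
  then show ?thesis using assms by simp
qed

lemma same_label_same_letter:
  assumes "m \<ge> 1" "m_word m w" "i < length w" "j < length w" "rank w i div m = rank w j div m"
  shows "w ! i = w ! j"
  using rank_div_less_letter_iff[OF assms(1-3), of "w ! i"] rank_div_less_letter_iff[OF assms(1-3), of "w ! j"]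
    rank_div_less_letter_iff[OF assms(1,2,4), of "w ! i"] rank_div_less_letter_iff[OF assms(1,2,4), of "w ! j"] assms(5)
  by (metis less_irrefl linorder_neqE_nat)

lemma set_take_filter_upt:
  "set (take m (filter P [0..<n])) = {p. p < n \<and> P p \<and> card {q. q < p \<and> P q} < m}"
proof (induction n)
  case (Suc n)
  have len: "length (filter P [0..<n]) = card {q. q < n \<and> P q}"
    by (subst length_filter_conv_card, rule arg_cong[where f = card]) auto
  have "set (take m (filter P [0..<Suc n])) = set (take m (filter P [0..<n])) \<union>
      (if P n \<and> card {q. q < n \<and> P q} < m then {n} else {})"
    using len by (auto simp: take_Cons')
  then show ?case
    unfolding Suc by (auto simp: less_Suc_eq)
qed simp

text \<open>Induction on the rounds. The next \<open>m\<close> ranks all carry the smallest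
  remaining letter, since ranks with the same quotient by \<open>m\<close> have the same letter, and
  among the occurrences of one letter the ranking runs from left to right.\<close>

lemma unlabelled_eq:
  assumes m: "m \<ge> 1" and w: "m_word m w"
  shows "unlabelled m w j = {i. i < length w \<and> m * j \<le> rank w i}"
proof (induction j)
  case (Suc j)
  let ?U = "{i. i < length w \<and> m * j \<le> rank w i}"
  show ?case
  proof (cases "m * j < length w")
    case False
    \<comment> \<open>All positions are labelled. The \<open>Min\<close> of the empty set is
      unspecified, but removing anything from the empty set changes nothing.\<close>
    then have "?U = {}" using rank_less_length[of _ w] by fastforce
    then show ?thesis using Suc by (auto simp: Let_def)
  next
    case True
    then obtain p0 where p0: "p0 < length w" "rank w p0 = m * j"
      using rank_image[of w] by (metis image_iff lessThan_iff)
    define a where "a = Min ((!) w ` ?U)"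
    have a: "a = w ! p0" unfolding a_def
    proof (rule Min_eqI)
      fix y assume "y \<in> (!) w ` ?U"
      then obtain p where p: "p < length w" "m * j \<le> rank w p" "y = w ! p" by auto
      then have "\<not> precedes w p p0" using p0 rank_less_iff[of p w p0] by simp
      then show "w ! p0 \<le> y" using p by (auto simp: precedes_def)
    qed (use p0 in auto)
    \<comment> \<open>The predecessors of \<open>p\<close> are the positions labelled so far and the
      unlabelled occurrences of \<open>a\<close> to its left; the number of the latter is what
      \<open>take m\<close> bounds.\<close>
    have rank_eq: "rank w p = m * j + card {q. q < p \<and> q \<in> ?U \<and> w ! q = a}"
      if p: "p \<in> ?U" "w ! p = a" for p
    proof -
      have "{q. q < length w \<and> precedes w q p} =
          {q. q < length w \<and> rank w q < m * j} \<union> {q. q < p \<and> q \<in> ?U \<and> w ! q = a}"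
        (is "?A = ?B \<union> ?C")
      proof (intro set_eqI iffI)
        fix q assume q: "q \<in> ?A"
        show "q \<in> ?B \<union> ?C"
        proof (cases "rank w q < m * j")
          case False
          then have "\<not> precedes w q p0" using q p0 rank_less_iff[of q w p0] by auto
          then have "w ! q \<ge> a" by (auto simp: a precedes_def)
          then show ?thesis using q p False by (auto simp: precedes_def)
        qed (use q in auto)
      next
        fix q assume "q \<in> ?B \<union> ?C"
        then show "q \<in> ?A" using p rank_less_iff[of q w p] by (auto simp: precedes_def)
      qed
      moreover have "card (?B \<union> ?C) = card ?B + card ?C" by (rule card_Un_disjoint) auto
      ultimately show ?thesis using card_rank_less[of "m * j" w] True by (simp add: rank_def[of w p])
    qed
    have letter: "w ! p = a" if "p \<in> ?U" "rank w p < m * j + m" for p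
    proof -
      have "rank w p div m < Suc j"
        using that m by (simp add: div_less_iff_less_mult mult.commute)
      moreover have "m * j div m \<le> rank w p div m"
        using that by (intro div_le_mono) simp
      ultimately have "rank w p div m = rank w p0 div m" using m p0 by simp
      then show ?thesis using same_label_same_letter[OF m w, of p p0] that p0 a by simp
    qed
    have "unlabelled m w (Suc j) =
        ?U - {p. p < length w \<and> (p \<in> ?U \<and> w ! p = a) \<and> card {q. q < p \<and> (q \<in> ?U \<and> w ! q = a)} < m}"
      by (simp only: unlabelled.simps Suc Let_def a_def[symmetric] set_take_filter_upt)
    also have "\<dots> = {i. i < length w \<and> m * Suc j \<le> rank w i}"
      (is "?L = ?R")
    proof (intro set_eqI)
      fix p
      have "p \<in> ?R \<longleftrightarrow> p \<in> ?U \<and> \<not> rank w p < m * j + m" by auto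
      also have "\<dots> \<longleftrightarrow> p \<in> ?U \<and> \<not> (w ! p = a \<and> rank w p < m * j + m)" using letter[of p] by blast
      also have "\<dots> \<longleftrightarrow> p \<in> ?L" using rank_eq[of p] by auto
      finally show "p \<in> ?L \<longleftrightarrow> p \<in> ?R" by simp
    qed
    finally show ?thesis .
  qed
qed auto

lemma length_std [simp]: "length (std m w) = length w"
  by (simp add: std_def)

text \<open>Labels start at 1 while ranks start at 0: position \<open>i\<close> is labelled in the
  first round \<open>j\<close> with \<open>rank w i < m * j\<close>.\<close>

lemma std_nth:
  assumes "m \<ge> 1" "m_word m w" "i < length w"
  shows "std m w ! i = Suc (rank w i div m)"
proof -
  have "(LEAST j. i \<notin> unlabelled m w j) = (LEAST j. rank w i div m < j)"
    using assms by (simp add: unlabelled_eq not_le div_less_iff_less_mult mult.commute)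
  also have "\<dots> = Suc (rank w i div m)" by (rule Least_equality) auto
  finally show ?thesis using assms by (simp add: std_def)
qed

section \<open>Order equivalence as the invariant behind standardization\<close>

lemma order_equiv_sym: "order_equiv v w \<Longrightarrow> order_equiv w v"
  by (simp add: order_equiv_def)

lemma order_equiv_trans: "order_equiv u v \<Longrightarrow> order_equiv v w \<Longrightarrow> order_equiv u w"
  by (simp add: order_equiv_def)

lemma order_equiv_take: "order_equiv v w \<Longrightarrow> order_equiv (take n v) (take n w)"
  by (auto simp: order_equiv_def)

lemma order_equiv_drop: "order_equiv v w \<Longrightarrow> order_equiv (drop n v) (drop n w)"
  by (auto simp: order_equiv_def)

lemma order_equiv_map: "strict_mono_on (set w) f \<Longrightarrow> order_equiv (map f w) w"
  by (auto simp: order_equiv_def strict_mono_on_leD strict_mono_on_less_eq)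

text \<open>Pairing the letters turns order equivalence into a condition that survives filtering
  both words by matching predicates.\<close>

lemma order_equiv_iff_zip:
  "order_equiv v w \<longleftrightarrow> length v = length w \<and> sorted_wrt (\<lambda>(a, b) (c, d). a \<le> c \<longleftrightarrow> b \<le> d) (zip v w)"
  by (auto simp: order_equiv_def sorted_wrt_iff_nth_less)

lemma order_equiv_precedes:
  assumes "order_equiv v w" "i < length w" "j < length w"
  shows "precedes v i j \<longleftrightarrow> precedes w i j"
proof -
  have prec: "precedes u i j \<longleftrightarrow> (if i < j then u ! i \<le> u ! j else \<not> u ! j \<le> u ! i)" for u
    by (auto simp: precedes_def)
  consider "i < j" | "j < i" | "i = j" by linarith
  then show ?thesis
    using assms by cases (auto simp: prec order_equiv_def)
qed

lemma order_equiv_rank: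
  assumes "order_equiv v w" "i < length w" shows "rank v i = rank w i"
  unfolding rank_def using assms order_equiv_precedes[OF assms(1) _ assms(2)]
  by (intro arg_cong[where f = card]) (auto simp: order_equiv_def)

lemma order_equiv_std:
  assumes "m \<ge> 1" "m_word m v" "m_word m w" "order_equiv v w" shows "std m v = std m w"
  using assms by (intro nth_equalityI) (auto simp: std_nth order_equiv_rank order_equiv_def[THEN iffD1])

text \<open>A weak ascent gives increasing ranks, hence weakly increasing labels. A descent gives
  decreasing ranks, and equal labels are excluded because the letters differ.\<close>

lemma order_equiv_std_self:
  assumes "m \<ge> 1" "m_word m w" shows "order_equiv (std m w) w"
proof -
  have "std m w ! i \<le> std m w ! j \<longleftrightarrow> w ! i \<le> w ! j" if ij: "i < j" "j < length w" for i j
  proof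
    assume "w ! i \<le> w ! j"
    then have "rank w i < rank w j" using ij by (subst rank_less_iff) (auto simp: precedes_def)
    then show "std m w ! i \<le> std m w ! j" using assms ij by (simp add: std_nth div_le_mono)
  next
    assume le: "std m w ! i \<le> std m w ! j"
    show "w ! i \<le> w ! j"
    proof (rule ccontr)
      assume gt: "\<not> w ! i \<le> w ! j"
      then have "rank w j < rank w i" using ij by (subst rank_less_iff) (auto simp: precedes_def)
      then have "rank w j div m = rank w i div m"
        using le assms ij by (auto simp: std_nth intro!: antisym div_le_mono)
      then show False using same_label_same_letter[of m w j i] assms ij gt by simp
    qed
  qed
  then show ?thesis by (auto simp: order_equiv_def)
qed

lemma std_eq_iff_order_equiv:
  assumes "m \<ge> 1" "m_word m v" "m_word m w"
  shows "std m v = std m w \<longleftrightarrow> order_equiv v w"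
  using assms order_equiv_std order_equiv_std_self order_equiv_sym order_equiv_trans by metis

section \<open>The m-permutations as the fixed points of standardization\<close>

lemma card_rank_div_eq:
  assumes m: "m \<ge> 1" and c: "m * Suc c \<le> length w"
  shows "card {i. i < length w \<and> rank w i div m = c} = m"
proof -
  let ?R = "\<lambda>n. {i. i < length w \<and> rank w i < n}"
  have "{i. i < length w \<and> rank w i div m = c} = ?R (m * Suc c) - ?R (m * c)"
  proof -
    have "rank w i div m = c \<longleftrightarrow> rank w i div m < Suc c \<and> \<not> rank w i div m < c" for i by auto
    then show ?thesis using m by (auto simp: div_less_iff_less_mult mult.commute)
  qed
  moreover have "card (?R (m * Suc c) - ?R (m * c)) = card (?R (m * Suc c)) - card (?R (m * c))"
    by (rule card_Diff_subset) auto
  ultimately show ?thesis using c by (simp add: card_rank_less)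
qed

lemma std_in_m_perms:
  assumes "m \<ge> 1" "m_word m w" "length w = m * n"
  shows "std m w \<in> m_perms m n"
proof -
  have "std m w ! i \<in> {1..n}" if "i < length w" for i
    using that assms rank_less_length[OF that] by (simp add: std_nth Suc_le_eq div_less_iff_less_mult mult.commute)
  then have "set (std m w) \<subseteq> {1..n}" by (auto simp: in_set_conv_nth)
  moreover have "count_list (std m w) c = m" if c: "c \<in> {1..n}" for c
  proof -
    obtain d where d: "c = Suc d" "d < n" using c by (cases c) auto
    have "count_list (std m w) c = card {i. i < length w \<and> rank w i div m = d}"
      unfolding count_list_card using assms d by (intro arg_cong[where f = card]) (auto simp: std_nth)
    also have "\<dots> = m" using assms d by (intro card_rank_div_eq) (auto simp del: mult_Suc_right)
    finally show ?thesis .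
  qed
  ultimately show ?thesis by (simp add: m_perms_def)
qed

lemma m_perms_m_word: "\<alpha> \<in> m_perms m n \<Longrightarrow> m_word m \<alpha>"
proof -
  assume \<alpha>: "\<alpha> \<in> m_perms m n"
  have "m dvd count_list \<alpha> a" for a
  proof (cases "a \<in> {1..n}")
    case False
    then have "a \<notin> set \<alpha>" using \<alpha> by (auto simp: m_perms_def)
    then show ?thesis by simp
  qed (use \<alpha> in \<open>simp add: m_perms_def\<close>)
  then show ?thesis using \<alpha> by (auto simp: m_word_def is_word_def m_perms_def)
qed

lemma card_m_perms_le:
  assumes "\<alpha> \<in> m_perms m n" "k \<le> n"
  shows "card {i. i < length \<alpha> \<and> \<alpha> ! i \<le> k} = m * k"
proof -
  have "{i. i < length \<alpha> \<and> \<alpha> ! i \<le> k} = (\<Union>c\<in>{1..k}. {i. i < length \<alpha> \<and> \<alpha> ! i = c})"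
    using assms by (auto simp: m_perms_def Suc_le_eq) (metis atLeastAtMost_iff nth_mem subsetD not_less_eq_eq zero_less_iff_neq_zero le_0_eq One_nat_def)+
  moreover have "card \<dots> = (\<Sum>c\<in>{1..k}. card {i. i < length \<alpha> \<and> \<alpha> ! i = c})"
    by (rule card_UN_disjoint) auto
  moreover have "\<dots> = (\<Sum>c\<in>{1..k}. m)"
    using assms by (intro sum.cong) (auto simp: m_perms_def simp flip: count_list_card)
  ultimately show ?thesis by simp
qed

lemma length_m_perms:
  assumes "\<alpha> \<in> m_perms m n" shows "length \<alpha> = m * n"
proof -
  have "{i. i < length \<alpha> \<and> \<alpha> ! i \<le> n} = {..<length \<alpha>}"
    using assms nth_mem by (fastforce simp: m_perms_def)
  then show ?thesis using card_m_perms_le[OF assms order_refl] by simp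
qed

text \<open>The letters up to \<open>k\<close> occupy \<open>m * k\<close> positions, so the
  threshold lemma for letters, applied at \<open>\<alpha> ! i\<close> and its successor, traps the
  rank quotient at \<open>\<alpha> ! i - 1\<close>.\<close>

lemma std_m_perms:
  assumes "m \<ge> 1" "\<alpha> \<in> m_perms m n" shows "std m \<alpha> = \<alpha>"
proof (rule nth_equalityI)
  fix i assume "i < length (std m \<alpha>)"
  then have i: "i < length \<alpha>" by simp
  then have a: "\<alpha> ! i \<in> {1..n}" using assms nth_mem by (fastforce simp: m_perms_def)
  have card: "card {l. l < length \<alpha> \<and> \<alpha> ! l < Suc k} div m = k" if "k \<le> n" for k
    using card_m_perms_le[OF assms(2) that] assms(1) by (simp add: less_Suc_eq_le)
  note iff = rank_div_less_letter_iff[OF assms(1) m_perms_m_word[OF assms(2)] i]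
  have "rank \<alpha> i div m < \<alpha> ! i"
    using iff[of "Suc (\<alpha> ! i)"] card[of "\<alpha> ! i"] a by simp
  moreover have "\<not> rank \<alpha> i div m < \<alpha> ! i - 1"
    using iff[of "\<alpha> ! i"] card[of "\<alpha> ! i - 1"] a by auto
  ultimately show "std m \<alpha> ! i = \<alpha> ! i"
    using i assms by (simp add: std_nth m_perms_m_word)
qed simp

lemma m_word_std:
  assumes "m \<ge> 1" "m_word m w" shows "m_word m (std m w)"
  using m_word_dvd_length[OF assms(2)] std_in_m_perms[OF assms] m_perms_m_word by blast

lemma is_word_std:
  assumes "m \<ge> 1" "m_word m w" shows "is_word (std m w)"
  using m_word_std[OF assms] by (simp add: m_word_def)

lemma std_std:
  assumes "m \<ge> 1" "m_word m w" shows "std m (std m w) = std m w"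
  using m_word_dvd_length[OF assms(2)] std_in_m_perms[OF assms] std_m_perms[OF assms(1)] by blast

section \<open>Cutting m-words by position\<close>

lemma m_word_append: "m_word m u \<Longrightarrow> m_word m v \<Longrightarrow> m_word m (u @ v)"
  by (auto simp: m_word_def is_word_def)

lemma m_word_drop:
  assumes "m_word m w" "m_word m (take n w)" shows "m_word m (drop n w)"
proof -
  have "count_list w a = count_list (take n w) a + count_list (drop n w) a" for a
    by (metis append_take_drop_id count_list_append)
  then have "m dvd count_list (drop n w) a" for a
    using assms by (metis dvd_add_right_iff m_word_def)
  then show ?thesis using assms set_drop_subset[of n w] by (auto simp: m_word_def is_word_def)
qed

text \<open>The occurrences of one letter get their labels from left to right in groups of \<open>m\<close>, so a cut
  that separates no group of \<open>w\<close> separates no group of \<open>std m w\<close>, and conversely.\<close>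

lemma m_word_take_std_iff:
  assumes m: "m \<ge> 1" and w: "m_word m w"
  shows "m_word m (take n (std m w)) \<longleftrightarrow> m_word m (take n w)"
proof -
  let ?g = "std m w" and ?k = "min n (length w)"
  have count_take: "count_list (take n u) a = card {i. i < ?k \<and> u ! i = a}" if "length u = length w" for u a
    unfolding count_list_card using that by (intro arg_cong[where f = card]) auto
  have words: "is_word (take n w)" "is_word (take n ?g)"
    using w is_word_std[OF m w] set_take_subset by (fastforce simp: m_word_def is_word_def)+
  have same: "w ! i = w ! j" if "i < length w" "j < length w" "?g ! i = ?g ! j" for i j
    using same_label_same_letter[OF m w, of i j] that m w by (simp add: std_nth)
  show ?thesis
  proof
    assume "m_word m (take n ?g)"
    then have dvd: "m dvd card {i. i < ?k \<and> ?g ! i = c}" for c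
      by (simp add: m_word_def count_take)
    have "m dvd card {i. i < ?k \<and> w ! i = a}" for a
    proof -
      \<comment> \<open>By \<open>same\<close> the letter is a function of the label, so the
        occurrences of \<open>a\<close> are described through labels alone and
        \<open>dvd_card_positions\<close> applies to \<open>?g\<close>.\<close>
      have "{i. i < ?k \<and> w ! i = a} = {i. i < ?k \<and> (\<exists>j<length w. ?g ! j = ?g ! i \<and> w ! j = a)}"
      proof (intro Collect_cong conj_cong refl)
        fix i assume "i < ?k"
        then have "i < length w" by simp
        then show "w ! i = a \<longleftrightarrow> (\<exists>j<length w. ?g ! j = ?g ! i \<and> w ! j = a)"
          using same[of i] by metis
      qed
      then show ?thesis using dvd_card_positions[of m ?k ?g "\<lambda>c. \<exists>j<length w. ?g ! j = c \<and> w ! j = a"] dvd by simp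
    qed
    then show "m_word m (take n w)" using words by (simp add: m_word_def count_take)
  next
    assume "m_word m (take n w)"
    then have dvd: "m dvd card {i. i < ?k \<and> w ! i = a}" for a
      by (simp add: m_word_def count_take)
    have side: "\<not> (i < ?k \<and> ?k \<le> j)" if ij: "i < length w" "j < length w" "?g ! i = ?g ! j" for i j
    proof
      assume cut: "i < ?k \<and> ?k \<le> j"
      define a where "a = w ! i"
      have a: "w ! j = a" using same[OF ij] by (simp add: a_def)
      \<comment> \<open>The initial segment of the ranking that ends at the cut among the
        occurrences of \<open>a\<close> contains \<open>i\<close> but not \<open>j\<close>. Its size
        is a multiple of \<open>m\<close>, so labels decide membership in it, contradicting the
        equal labels of \<open>i\<close> and \<open>j\<close>.\<close>
      let ?D = "{l. l < length w \<and> (w ! l < a \<or> (w ! l = a \<and> l < ?k))}"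
      have D: "?D = {l. l < length w \<and> w ! l < a} \<union> {l. l < ?k \<and> w ! l = a}" by auto
      have "card ?D = card {l. l < length w \<and> w ! l < a} + card {l. l < ?k \<and> w ! l = a}"
        unfolding D by (rule card_Un_disjoint) auto
      then have "m dvd card ?D" using m_word_dvd_card[OF w, of "\<lambda>b. b < a"] dvd by simp
      then have "rank w l div m < card ?D div m \<longleftrightarrow> l \<in> ?D" if "l < length w" for l
        by (intro rank_div_less_iff m that) (auto simp: precedes_def)
      from this[of i] this[of j] show False
        using ij m w cut a by (simp add: std_nth a_def min_le_iff_disj)
    qed
    have "m dvd card {i. i < ?k \<and> ?g ! i = c}" for c
    proof (cases "\<exists>i<?k. ?g ! i = c")
      case True
      then have "{i. i < ?k \<and> ?g ! i = c} = {i. i < length ?g \<and> ?g ! i = c}"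
        using side by auto (metis leI min_less_iff_conj)+
      then show ?thesis using m_word_std[OF m w] by (simp add: m_word_def count_list_card)
    next
      case False
      then have "{i. i < ?k \<and> ?g ! i = c} = {}" by auto
      then show ?thesis by (simp only: card.empty dvd_0_right)
    qed
    then show "m_word m (take n ?g)" using words by (simp add: m_word_def count_take)
  qed
qed

lemma m_word_drop_std_iff:
  assumes m: "m \<ge> 1" and w: "m_word m w" and "m_word m (take n w)"
  shows "m_word m (drop n (std m w)) \<and> m_word m (drop n w)"
  using assms m_word_drop m_word_std m_word_take_std_iff by blast

lemma std_take_std:
  assumes "m \<ge> 1" "m_word m w" "m_word m (take n w)"
  shows "std m (take n (std m w)) = std m (take n w)"
  using assms by (intro order_equiv_std) (auto simp: m_word_take_std_iff order_equiv_take order_equiv_std_self)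

lemma std_drop_std:
  assumes "m \<ge> 1" "m_word m w" "m_word m (take n w)"
  shows "std m (drop n (std m w)) = std m (drop n w)"
  using assms by (intro order_equiv_std) (auto simp: m_word_drop_std_iff order_equiv_drop order_equiv_std_self)

section \<open>The spaces of series and the product\<close>

lemma sum_apply: "(\<Sum>i\<in>I. h i) x = (\<Sum>i\<in>I. h i x)"
  by (induction I rule: infinite_finite_induct) auto

text \<open>In the applications \<open>P\<close> is the class of words carrying the series and
  \<open>p\<close> sends a word to a representative of its class. The bound on the length is the
  bounded degree of \<open>free_algebra\<close>.\<close>

definition invariant_series :: "(nat list \<Rightarrow> bool) \<Rightarrow> (nat list \<Rightarrow> nat list) \<Rightarrow> 'k::field series set" where
  "invariant_series P p = {f. (\<forall>w. f w \<noteq> 0 \<longrightarrow> P w) \<and> (\<exists>d. \<forall>w. f w \<noteq> 0 \<longrightarrow> length w \<le> d) \<and>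
     (\<forall>w. P w \<longrightarrow> f (p w) = f w)}"

lemma subspace_invariant_series: "fun_space.subspace (invariant_series P p :: 'k::field series set)"
proof (rule fun_space.subspaceI)
  show "0 \<in> (invariant_series P p :: 'k series set)" by (simp add: invariant_series_def)
next
  fix f g :: "'k series" assume fg: "f \<in> invariant_series P p" "g \<in> invariant_series P p"
  then obtain d e where "\<And>w. f w \<noteq> 0 \<Longrightarrow> length w \<le> d" "\<And>w. g w \<noteq> 0 \<Longrightarrow> length w \<le> e"
    unfolding invariant_series_def by blast
  then have "length w \<le> max d e" if "(f + g) w \<noteq> 0" for w
    using that by (cases "f w = 0") (auto simp: le_max_iff_disj)
  moreover have "P w" if "(f + g) w \<noteq> 0" for w
    using that fg by (cases "f w = 0") (auto simp: invariant_series_def)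
  ultimately show "f + g \<in> invariant_series P p"
    using fg unfolding invariant_series_def by auto
next
  fix c and f :: "'k series" assume "f \<in> invariant_series P p"
  then show "fscale c f \<in> invariant_series P p" by (auto simp: invariant_series_def fscale_def)
qed

text \<open>An invariant series is the combination of the indicators of the fibres of
  \<open>p\<close>, with its values at the fixed points of \<open>p\<close> as coefficients. Bounded
  degree together with \<open>fin\<close> makes this combination finite.\<close>

lemma span_indicators_eq_invariant_series:
  assumes p: "\<And>w. P w \<Longrightarrow> P (p w) \<and> p (p w) = p w \<and> length (p w) = length w"
    and fin: "\<And>d. finite (p ` {w. P w \<and> length w \<le> d})"
  shows "fun_space.span {(\<lambda>w. if P w \<and> p w = u then 1 else 0 :: 'k::field) | u. P u \<and> p u = u} = invariant_series P p"
    (is "fun_space.span ?B = _")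
proof (rule equalityI)
  have "?B \<subseteq> invariant_series P p"
  proof clarify
    fix u assume "P u" "p u = u"
    then show "(\<lambda>w. if P w \<and> p w = u then 1 else 0 :: 'k) \<in> invariant_series P p"
      unfolding invariant_series_def mem_Collect_eq
      using p by (intro conjI allI impI exI[of _ "length u"]) (force split: if_splits)+
  qed
  then show "fun_space.span ?B \<subseteq> invariant_series P p"
    using subspace_invariant_series by (rule fun_space.span_minimal)
next
  show "invariant_series P p \<subseteq> fun_space.span ?B"
  proof
    fix f :: "'k series" assume f: "f \<in> invariant_series P p"
    then obtain d where d: "\<And>w. f w \<noteq> 0 \<Longrightarrow> length w \<le> d" unfolding invariant_series_def by blast
    have supp: "P w" if "f w \<noteq> 0" for w using f that by (auto simp: invariant_series_def)
    have inv: "f (p w) = f w" if "P w" for w using f that by (auto simp: invariant_series_def)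
    define A where "A = {u. P u \<and> p u = u \<and> f u \<noteq> 0}"
    have "A \<subseteq> p ` {w. P w \<and> length w \<le> d}" using d by (force simp: A_def image_iff)
    then have A: "finite A" using fin finite_subset by blast
    have "f = (\<Sum>u\<in>A. fscale (f u) (\<lambda>w. if P w \<and> p w = u then 1 else 0))"
    proof
      fix w
      have "(\<Sum>u\<in>A. fscale (f u) (\<lambda>w. if P w \<and> p w = u then 1 else 0)) w =
          (\<Sum>u\<in>A. if u = p w then (if P w then f u else 0) else 0)"
        by (auto simp: sum_apply fscale_def intro!: sum.cong)
      also have "\<dots> = (if p w \<in> A \<and> P w then f (p w) else 0)" using A by simp
      also have "\<dots> = f w" using supp[of w] inv[of w] p[of w] by (cases "P w") (auto simp: A_def)
      finally show "f w = (\<Sum>u\<in>A. fscale (f u) (\<lambda>w. if P w \<and> p w = u then 1 else 0)) w" by simp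
    qed
    also have "\<dots> \<in> fun_space.span ?B"
      by (intro fun_space.span_sum fun_space.span_scale fun_space.span_base) (auto simp: A_def)
    finally show "f \<in> fun_space.span ?B" .
  qed
qed

section \<open>The concatenation product\<close>

lemma mult_apply: "mult f g w = (\<Sum>i\<le>length w. f (take i w) * g (drop i w))"
  by (simp add: mult_def mult2_def tens_def)

text \<open>The product is compared at \<open>p w\<close> and \<open>w\<close> cut by cut. A cut
  contributes only if both factors satisfy \<open>P\<close>; by \<open>cut\<close> this happens
  simultaneously for both words, and by \<open>p_cut\<close> the factors then have the same normal
  forms.\<close>

lemma mult_invariant_series:
  assumes fg: "f \<in> invariant_series P p" "g \<in> invariant_series P p"
    and append: "\<And>u v. P u \<Longrightarrow> P v \<Longrightarrow> P (u @ v)"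
    and len: "\<And>w. P w \<Longrightarrow> length (p w) = length w"
    and cut: "\<And>w i. P w \<Longrightarrow> P (take i (p w)) \<and> P (drop i (p w)) \<longleftrightarrow> P (take i w) \<and> P (drop i w)"
    and p_cut: "\<And>w i. P w \<Longrightarrow> P (take i w) \<Longrightarrow> P (drop i w) \<Longrightarrow>
       p (take i (p w)) = p (take i w) \<and> p (drop i (p w)) = p (drop i w)"
  shows "mult f g \<in> invariant_series P p"
proof -
  obtain d e where de: "\<And>w. f w \<noteq> 0 \<Longrightarrow> length w \<le> d" "\<And>w. g w \<noteq> 0 \<Longrightarrow> length w \<le> e"
    using fg unfolding invariant_series_def by blast
  have supp: "P w" if "f w \<noteq> 0 \<or> g w \<noteq> 0" for w using fg that by (auto simp: invariant_series_def)
  have inv: "f (p w) = f w \<and> g (p w) = g w" if "P w" for w using fg that by (auto simp: invariant_series_def)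
  have factors: "\<exists>i. f (take i w) \<noteq> 0 \<and> g (drop i w) \<noteq> 0" if "mult f g w \<noteq> 0" for w
    using that unfolding mult_apply by (metis (no_types, lifting) mult_eq_0_iff sum.neutral)
  have "P w" if "mult f g w \<noteq> 0" for w
    using factors that supp append append_take_drop_id by metis
  moreover have "length w \<le> d + e" if nz: "mult f g w \<noteq> 0" for w
  proof -
    obtain i where "f (take i w) \<noteq> 0" "g (drop i w) \<noteq> 0" using factors[OF nz] by blast
    then have "length (take i w) + length (drop i w) \<le> d + e" using de add_mono by blast
    then show ?thesis by (metis append_take_drop_id length_append)
  qed
  moreover have "mult f g (p w) = mult f g w" if w: "P w" for w
  proof -
    have "f (take i (p w)) * g (drop i (p w)) = f (take i w) * g (drop i w)" for i
    proof (cases "P (take i w) \<and> P (drop i w)")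
      case True
      then show ?thesis using cut[OF w, of i] p_cut[OF w, of i] inv by metis
    next
      case False
      then show ?thesis using cut[OF w, of i] supp by (metis mult_eq_0_iff)
    qed
    then show ?thesis by (simp add: mult_apply len[OF w])
  qed
  ultimately show ?thesis unfolding invariant_series_def by blast
qed

lemma mult_assoc_series: "mult (mult f g) h = mult f (mult g h)"
proof
  fix w :: "nat list"
  define F where "F j l = f (take j w) * (g (take l (drop j w)) * h (drop (j + l) w))" for j l
  let ?n = "length w"
  have "mult (mult f g) h w = (\<Sum>k\<le>?n. \<Sum>j\<le>k. F j (k - j))"
    by (auto simp: mult_apply F_def sum_distrib_right mult.assoc min_absorb2 min_absorb1 drop_take intro!: sum.cong)
  \<comment> \<open>Both iterated products sum over the ways to cut \<open>w\<close> into three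
    factors, \<open>j\<close> and \<open>l\<close> being the lengths of the first two.\<close>
  also have "\<dots> = (\<Sum>(j, l)\<in>{(j, l). j + l \<le> ?n}. F j l)"
    by (rule sum.triangle_reindex_eq[symmetric])
  also have "{(j, l). j + l \<le> ?n} = (SIGMA j:{..?n}. {..?n - j})" by auto
  also have "(\<Sum>(j, l)\<in>\<dots>. F j l) = (\<Sum>j\<le>?n. \<Sum>l\<le>?n - j. F j l)"
    by (rule sum.Sigma[symmetric]) auto
  also have "\<dots> = mult f (mult g h) w"
    by (simp add: mult_apply F_def sum_distrib_left add.commute)
  finally show "mult (mult f g) h w = mult f (mult g h) w" .
qed

lemma mult_sum_left: "mult (\<Sum>k\<in>K. f k) g = (\<Sum>k\<in>K. mult (f k) g)"
  by (rule ext) (simp add: mult_apply sum_apply sum_distrib_right, rule sum.swap)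

lemma mult_sum_right: "mult f (\<Sum>k\<in>K. g k) = (\<Sum>k\<in>K. mult f (g k))"
  by (rule ext) (simp add: mult_apply sum_apply sum_distrib_left, rule sum.swap)

lemma mult_fscale_left: "mult (fscale c f) g = fscale c (mult f g)"
  by (rule ext) (simp add: mult_apply fscale_def sum_distrib_left mult.assoc)

lemma mult_unit_left: "mult unit_series f = f"
proof
  fix w
  have "mult unit_series f w = (\<Sum>i\<le>length w. if i = 0 then f w else 0)"
    unfolding mult_apply by (intro sum.cong) (auto simp: unit_series_def)
  then show "mult unit_series f w = f w" by simp
qed

lemma mult_unit_right: "mult f unit_series = f"
proof
  fix w
  have "mult f unit_series w = (\<Sum>i\<le>length w. if i = length w then f w else 0)"
    unfolding mult_apply by (intro sum.cong) (auto simp: unit_series_def)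
  then show "mult f unit_series w = f w" by simp
qed

lemma mult_zero_left: "mult 0 f = 0"
  by (rule ext) (simp add: mult_apply)

lemma mult_zero_right: "mult f 0 = 0"
  by (rule ext) (simp add: mult_apply)

lemma mult2_sum_tens: "mult2 (\<Sum>k\<in>K. tens (f k) (g k)) = (\<Sum>k\<in>K. mult (f k) (g k))"
  unfolding mult_def by (rule ext) (simp add: mult2_def sum_apply, rule sum.swap)

section \<open>Packing\<close>

lemma strict_mono_on_card_le:
  fixes S :: "nat set"
  assumes "finite S" shows "strict_mono_on S (\<lambda>b. card {a \<in> S. a \<le> b})"
proof (intro strict_mono_onI psubset_card_mono psubsetI)
  fix r s assume "r \<in> S" "s \<in> S" "r < s"
  then have "s \<in> {a \<in> S. a \<le> s} - {a \<in> S. a \<le> r}" by simp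
  then show "{a \<in> S. a \<le> r} \<noteq> {a \<in> S. a \<le> s}" by blast
qed (use assms in auto)

lemma length_pack [simp]: "length (pack w) = length w"
  by (simp add: pack_def)

lemma pack_Nil [simp]: "pack [] = []"
  by (simp add: pack_def)

text \<open>A strictly increasing \<open>f\<close> maps the letters up to \<open>b\<close>
  bijectively onto those up to \<open>f b\<close>, so the counts taken by \<open>pack\<close>
  agree.\<close>

lemma pack_map:
  assumes "strict_mono_on (set w) f" shows "pack (map f w) = pack w"
proof -
  have "card {a \<in> f ` set w. a \<le> f b} = card {a \<in> set w. a \<le> b}" if b: "b \<in> set w" for b
  proof -
    have "{a \<in> f ` set w. a \<le> f b} = f ` {a \<in> set w. a \<le> b}"
      using assms b by (auto simp: strict_mono_on_less_eq)
    moreover have "inj_on f {a \<in> set w. a \<le> b}"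
      by (rule inj_on_subset[OF strict_mono_on_imp_inj_on[OF assms]]) auto
    ultimately show ?thesis by (simp add: card_image)
  qed
  then show ?thesis by (simp add: pack_def)
qed

lemma pack_eq_map: obtains f where "strict_mono_on (set w) f" "pack w = map f w"
  using that[OF strict_mono_on_card_le[of "set w"]] by (simp add: pack_def)

lemma pack_take_pack: "pack (take i (pack w)) = pack (take i w)"
proof -
  obtain f where f: "strict_mono_on (set w) f" "pack w = map f w" by (rule pack_eq_map)
  have "strict_mono_on (set (take i w)) f" using f(1) set_take_subset by (rule monotone_on_subset)
  then show ?thesis by (simp add: f(2) take_map pack_map)
qed

lemma pack_drop_pack: "pack (drop i (pack w)) = pack (drop i w)"
proof -
  obtain f where f: "strict_mono_on (set w) f" "pack w = map f w" by (rule pack_eq_map)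
  have "strict_mono_on (set (drop i w)) f" using f(1) set_drop_subset by (rule monotone_on_subset)
  then show ?thesis by (simp add: f(2) drop_map pack_map)
qed

lemma pack_pack [simp]: "pack (pack w) = pack w"
  using pack_take_pack[of "length w" w] by simp

lemma packed_pack [simp]: "packed (pack w)"
  by (simp add: packed_def)

lemma is_word_pack [simp]: "is_word (pack w)"
  by (simp add: packed_imp_is_word)

lemma order_equiv_pack: "order_equiv (pack w) w"
  by (rule pack_eq_map[of w]) (simp add: order_equiv_map)

lemma set_pack: "set (pack w) = {1..card (set w)}"
proof (rule card_subset_eq)
  show "set (pack w) \<subseteq> {1..card (set w)}"
    using is_word_pack[of w] by (auto simp: is_word_def) (auto simp: pack_def intro: card_mono)
  obtain f where f: "strict_mono_on (set w) f" "pack w = map f w" by (rule pack_eq_map)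
  then show "card (set (pack w)) = card {1..card (set w)}"
    by (simp add: card_image strict_mono_on_imp_inj_on)
qed simp

lemma max_letter_eqI: "set u = {1..n} \<Longrightarrow> max_letter u = n"
  by (auto simp: max_letter_def intro: Max_eqI)

lemma packed_iff: "packed u \<longleftrightarrow> set u = {1..max_letter u}"
proof
  assume "packed u"
  then have "set u = {1..card (set u)}" using set_pack[of u] by (simp add: packed_def)
  then show "set u = {1..max_letter u}" using max_letter_eqI by metis
next
  assume u: "set u = {1..max_letter u}"
  have "card {a \<in> set u. a \<le> b} = b" if "b \<in> set u" for b
  proof -
    have "{a \<in> set u. a \<le> b} = {1..b}" using that by (subst (1) u, subst (asm) u) auto
    then show ?thesis by simp
  qed
  then show "packed u" by (simp add: packed_def pack_def map_idI)
qed

lemma packedI: "set u = {1..n} \<Longrightarrow> packed u"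
  using packed_iff max_letter_eqI by metis

lemma max_letter_pack: "max_letter (pack w) = card (set w)"
  by (rule max_letter_eqI) (rule set_pack)

lemma WQSym_eq_invariant_series: "(WQSym :: 'k::field series set) = invariant_series is_word pack"
proof -
  have "{M u | u. packed u} = {(\<lambda>w. if is_word w \<and> pack w = u then 1 else 0 :: 'k) | u. is_word u \<and> pack u = u}"
    unfolding M_def using packed_imp_is_word by (auto simp: packed_def)
  moreover have "finite (pack ` {w. is_word w \<and> length w \<le> d})" for d
  proof (rule finite_subset)
    show "pack ` {w. is_word w \<and> length w \<le> d} \<subseteq> {u. set u \<subseteq> {1..d} \<and> length u \<le> d}"
      using card_length order_trans by (fastforce simp: set_pack)
  qed (simp add: finite_lists_length_le)
  ultimately show ?thesis
    unfolding WQSym_def by (simp add: span_indicators_eq_invariant_series)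
qed

lemma is_word_take: "is_word w \<Longrightarrow> is_word (take i w)"
  by (auto simp: is_word_def dest: in_set_takeD)

lemma is_word_drop: "is_word w \<Longrightarrow> is_word (drop i w)"
  by (auto simp: is_word_def dest: in_set_dropD)

lemma is_word_append: "is_word u \<Longrightarrow> is_word v \<Longrightarrow> is_word (u @ v)"
  by (auto simp: is_word_def)

lemma mult_WQSym: "f \<in> WQSym \<Longrightarrow> g \<in> WQSym \<Longrightarrow> mult f g \<in> WQSym"
  unfolding WQSym_eq_invariant_series
  by (rule mult_invariant_series)
    (simp_all add: pack_take_pack pack_drop_pack is_word_take is_word_drop is_word_append)

lemma subspace_WQSym: "fun_space.subspace WQSym"
  by (simp add: WQSym_def fun_space.subspace_span)

section \<open>The span of the series \<open>G m \<alpha>\<close> inside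
  \<open>WQSym\<close>\<close>

lemma m_word_map_iff:
  assumes "inj_on f (set w)" "is_word w" "is_word (map f w)"
  shows "m_word m (map f w) \<longleftrightarrow> m_word m w"
proof -
  have "(\<forall>a. m dvd count_list v a) \<longleftrightarrow> (\<forall>a\<in>set v. m dvd count_list v a)" for v :: "nat list"
    by (metis count_notin dvd_0_right)
  then show ?thesis using assms by (simp add: m_word_def count_list_inj_map)
qed

lemma m_word_pack_iff: "is_word w \<Longrightarrow> m_word m (pack w) \<longleftrightarrow> m_word m w"
  by (metis m_word_map_iff pack_eq_map strict_mono_on_imp_inj_on is_word_pack)

lemma m_word_is_word: "m_word m w \<Longrightarrow> is_word w"
  by (simp add: m_word_def)

lemma std_pack: "m \<ge> 1 \<Longrightarrow> m_word m w \<Longrightarrow> std m (pack w) = std m w"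
  by (intro order_equiv_std order_equiv_pack) (auto simp: m_word_pack_iff m_word_is_word)

lemma m_word_std_fixed_iff:
  assumes "m \<ge> 1"
  shows "m_word m \<alpha> \<and> std m \<alpha> = \<alpha> \<longleftrightarrow> (\<exists>n. \<alpha> \<in> m_perms m n)"
  using assms m_word_dvd_length std_in_m_perms std_m_perms m_perms_m_word by (metis dvdE)

lemma mFQSym_dual_eq_invariant_series:
  assumes "m \<ge> 1"
  shows "(mFQSym_dual m :: 'k::field series set) = invariant_series (m_word m) (std m)"
proof -
  have "{G m \<alpha> | \<alpha> n. \<alpha> \<in> m_perms m n} =
      {(\<lambda>w. if m_word m w \<and> std m w = \<alpha> then 1 else 0 :: 'k) | \<alpha>. m_word m \<alpha> \<and> std m \<alpha> = \<alpha>}"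
    unfolding G_def m_word_std_fixed_iff[OF assms] by blast
  moreover have "finite (std m ` {w. m_word m w \<and> length w \<le> d})" for d
  proof (rule finite_subset)
    show "std m ` {w. m_word m w \<and> length w \<le> d} \<subseteq> {u. set u \<subseteq> {1..d} \<and> length u \<le> d}"
    proof clarify
      fix w assume w: "m_word m w" "length w \<le> d"
      then obtain n where n: "length w = m * n" using m_word_dvd_length by blast
      then have "n \<le> d" using assms w by (metis One_nat_def Suc_le_eq le_trans mult_le_mono1 nat_mult_1)
      then show "set (std m w) \<subseteq> {1..d} \<and> length (std m w) \<le> d"
        using std_in_m_perms[OF assms w(1) n] w(2) by (fastforce simp: m_perms_def)
    qed
  qed (simp add: finite_lists_length_le)
  ultimately show ?thesis
    unfolding mFQSym_dual_def using assms
    by (simp add: span_indicators_eq_invariant_series m_word_std std_std)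
qed

text \<open>Packing changes neither the m-word property nor the standardization, so invariance under
  \<open>std m\<close> implies invariance under \<open>pack\<close>.\<close>

lemma mFQSym_dual_subset_WQSym:
  assumes "m \<ge> 1" shows "mFQSym_dual m \<subseteq> (WQSym :: 'k::field series set)"
proof
  fix f :: "'k series" assume "f \<in> mFQSym_dual m"
  then have f: "f \<in> invariant_series (m_word m) (std m)" by (simp only: mFQSym_dual_eq_invariant_series[OF assms])
  have "f (pack w) = f w" if w: "is_word w" for w
  proof (cases "m_word m w")
    case True
    then have "f (pack w) = f (std m (pack w))" using f w by (simp add: invariant_series_def m_word_pack_iff)
    also have "\<dots> = f w" using f True assms by (simp add: std_pack invariant_series_def)
    finally show ?thesis .
  next
    case False
    then have "f w = 0" "f (pack w) = 0"
      using f w m_word_pack_iff[OF w, of m] unfolding invariant_series_def by blast+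
    then show ?thesis by simp
  qed
  then show "f \<in> WQSym"
    using f unfolding WQSym_eq_invariant_series by (auto simp: invariant_series_def m_word_is_word)
qed

lemma mult_mFQSym_dual:
  assumes "m \<ge> 1" "f \<in> mFQSym_dual m" "g \<in> mFQSym_dual m" shows "mult f g \<in> mFQSym_dual m"
proof -
  have "mult f g \<in> invariant_series (m_word m) (std m)"
  proof (rule mult_invariant_series)
    show "f \<in> invariant_series (m_word m) (std m)" "g \<in> invariant_series (m_word m) (std m)"
      using assms by (simp_all add: mFQSym_dual_eq_invariant_series)
    fix w i assume w: "m_word m w"
    show "m_word m (take i (std m w)) \<and> m_word m (drop i (std m w)) \<longleftrightarrow> m_word m (take i w) \<and> m_word m (drop i w)"
      using assms(1) w m_word_take_std_iff m_word_drop_std_iff by blast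
    assume "m_word m (take i w)"
    then show "std m (take i (std m w)) = std m (take i w) \<and> std m (drop i (std m w)) = std m (drop i w)"
      using assms(1) w std_take_std std_drop_std by blast
  qed (simp_all add: m_word_append)
  then show ?thesis using assms by (simp add: mFQSym_dual_eq_invariant_series)
qed

lemma G_in_mFQSym_dual: "\<alpha> \<in> m_perms m n \<Longrightarrow> G m \<alpha> \<in> mFQSym_dual m"
  unfolding mFQSym_dual_def by (rule fun_space.span_base) blast

lemma G_in_WQSym: "m \<ge> 1 \<Longrightarrow> \<alpha> \<in> m_perms m n \<Longrightarrow> G m \<alpha> \<in> WQSym"
  using G_in_mFQSym_dual mFQSym_dual_subset_WQSym by blast

section \<open>The product of two series \<open>G\<close>\<close>

lemma finite_star: "finite (star m \<alpha> \<beta>)"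
proof (rule finite_subset)
  show "star m \<alpha> \<beta> \<subseteq> {\<gamma>. set \<gamma> \<subseteq> {1..length \<alpha> + length \<beta>} \<and> length \<gamma> = length \<alpha> + length \<beta>}"
  proof
    fix \<gamma> assume "\<gamma> \<in> star m \<alpha> \<beta>"
    then obtain n where \<gamma>: "\<gamma> \<in> m_perms m n" and len: "length \<gamma> = length \<alpha> + length \<beta>"
      unfolding star_def by fastforce
    have "a \<le> length \<gamma>" if "a \<in> set \<gamma>" for a
    proof -
      have "a \<in> {1..n}" using \<gamma> that by (auto simp: m_perms_def)
      \<comment> \<open>A letter that occurs does so exactly \<open>m\<close> times, so
        \<open>m = 0\<close> cannot arise here.\<close>
      moreover have "m \<noteq> 0" using that \<gamma> \<open>a \<in> {1..n}\<close> count_list_0_iff[of \<gamma> a] by (auto simp: m_perms_def)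
      then have "n \<le> length \<gamma>" using length_m_perms[OF \<gamma>] by simp
      ultimately show ?thesis by simp
    qed
    then show "\<gamma> \<in> {\<gamma>. set \<gamma> \<subseteq> {1..length \<alpha> + length \<beta>} \<and> length \<gamma> = length \<alpha> + length \<beta>}"
      using \<gamma> len by (auto simp: m_perms_def)
  qed
qed (simp add: finite_lists_length_eq)

text \<open>Standardization preserves length, so only the cut at \<open>length \<alpha>\<close>
  contributes and the coefficient of \<open>w\<close> is 0 or 1. The cut condition is then
  transferred between \<open>w\<close> and \<open>std m w\<close>.\<close>

lemma mult_G:
  assumes m: "m \<ge> 1"
  shows "mult (G m \<alpha>) (G m \<beta>) = (\<Sum>\<gamma>\<in>star m \<alpha> \<beta>. G m \<gamma> :: 'k::field series)"
proof
  fix w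
  let ?i = "length \<alpha>"
  let ?split = "m_word m (take ?i w) \<and> m_word m (drop ?i w) \<and> std m (take ?i w) = \<alpha> \<and> std m (drop ?i w) = \<beta>"
  have split_len: "?i \<le> length w" if ?split
    using that by (metis length_std length_take min.cobounded1)
  have "mult (G m \<alpha>) (G m \<beta>) w = (\<Sum>i\<le>length w. if i = ?i then (if ?split then 1 else 0) else 0 :: 'k)"
    unfolding mult_apply
  proof (rule sum.cong[OF refl])
    fix i assume i: "i \<in> {..length w}"
    then have "i = ?i" if "std m (take i w) = \<alpha>"
      using arg_cong[OF that, of length] by simp
    then show "G m \<alpha> (take i w) * G m \<beta> (drop i w) = (if i = ?i then (if ?split then 1 else 0) else 0 :: 'k)"
      by (cases "i = ?i") (auto simp: G_def)
  qed
  also have "\<dots> = (if ?split then 1 else 0)" using split_len by simp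
  also have "?split \<longleftrightarrow> m_word m w \<and> std m w \<in> star m \<alpha> \<beta>"
  proof
    assume sp: ?split
    then have w: "m_word m w" by (metis append_take_drop_id m_word_append)
    have "\<exists>u v. std m w = u @ v \<and> m_word m u \<and> m_word m v \<and> std m u = \<alpha> \<and> std m v = \<beta>"
      using sp w m m_word_take_std_iff[OF m w, of ?i] m_word_drop_std_iff[OF m w, of ?i]
        std_take_std[OF m w, of ?i] std_drop_std[OF m w, of ?i] append_take_drop_id by metis
    moreover have "\<exists>n. std m w \<in> m_perms m n" using m_word_dvd_length[OF w] std_in_m_perms[OF m w] by blast
    ultimately show "m_word m w \<and> std m w \<in> star m \<alpha> \<beta>" using w by (simp add: star_def)
  next
    assume w: "m_word m w \<and> std m w \<in> star m \<alpha> \<beta>"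
    then obtain u v where uv: "std m w = u @ v" "m_word m u" "m_word m v" "std m u = \<alpha>" "std m v = \<beta>"
      unfolding star_def by blast
    then have len: "length u = ?i" by auto
    have eq: "take ?i (std m w) = u" "drop ?i (std m w) = v" using uv(1) len by simp_all
    have "m_word m (take ?i w)" using w uv eq m_word_take_std_iff[OF m, of w ?i] by simp
    then show ?split
      using w uv eq m m_word_drop_std_iff std_take_std[of m w ?i] std_drop_std[of m w ?i] by auto
  qed
  also have "(if m_word m w \<and> std m w \<in> star m \<alpha> \<beta> then 1 else 0) =
      (\<Sum>\<gamma>\<in>star m \<alpha> \<beta>. if \<gamma> = std m w then (if m_word m w then 1 else 0) else 0 :: 'k)"
    using finite_star by simp
  also have "\<dots> = (\<Sum>\<gamma>\<in>star m \<alpha> \<beta>. G m \<gamma>) w"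
    by (auto simp: sum_apply G_def intro!: sum.cong)
  finally show "mult (G m \<alpha>) (G m \<beta>) w = (\<Sum>\<gamma>\<in>star m \<alpha> \<beta>. G m \<gamma> :: 'k series) w" .
qed

section \<open>The antipode of WQSym\<close>

lemma lin_ext_sum:
  assumes "finite K" and fin: "\<And>k. k \<in> K \<Longrightarrow> finite {i. P i \<and> F k i \<noteq> 0}"
  shows "lin_ext P b (\<Sum>k\<in>K. F k) = (\<Sum>k\<in>K. lin_ext P b (F k))"
proof -
  let ?A = "\<Union>k\<in>K. {i. P i \<and> F k i \<noteq> 0}"
  have A: "finite ?A" using assms by blast
  have "lin_ext P b (\<Sum>k\<in>K. F k) = (\<Sum>i\<in>?A. fscale ((\<Sum>k\<in>K. F k) i) (b i))"
  proof (rule lin_ext_superset[OF A])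
    show "{i. P i \<and> (\<Sum>k\<in>K. F k) i \<noteq> 0} \<subseteq> ?A"
      by (auto simp: sum_apply) (metis (mono_tags, lifting) sum.neutral)
  qed auto
  also have "\<dots> = (\<Sum>i\<in>?A. \<Sum>k\<in>K. fscale (F k i) (b i))"
    by (simp add: fun_eq_iff sum_apply fscale_def sum_distrib_right)
  also have "\<dots> = (\<Sum>k\<in>K. \<Sum>i\<in>?A. fscale (F k i) (b i))"
    by (rule sum.swap)
  also have "\<dots> = (\<Sum>k\<in>K. lin_ext P b (F k))"
    by (intro sum.cong refl lin_ext_superset[OF A, symmetric]) auto
  finally show ?thesis .
qed

lemma lin_ext_in_subspace:
  assumes "fun_space.subspace U" "\<And>i. P i \<Longrightarrow> b i \<in> U" shows "lin_ext P b f \<in> U"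
  unfolding lin_ext_def using assms by (intro fun_space.subspace_sum fun_space.subspace_scale) auto

lemma linear_on_WQSym_lin_ext: "linear_on_WQSym (lin_ext packed b)"
  by (simp add: linear_on_WQSym_def lin_ext_add lin_ext_scale)

lemma linear_on_WQSym_id: "linear_on_WQSym id"
  by (simp add: linear_on_WQSym_def)

lemma tensor_map_sum_tens:
  assumes "linear_on_WQSym S" "linear_on_WQSym T" "finite K"
    and fg: "\<And>k. k \<in> K \<Longrightarrow> f k \<in> WQSym \<and> g k \<in> WQSym"
  shows "tensor_map S T (\<Sum>k\<in>K. tens (f k) (g k)) = (\<Sum>k\<in>K. tens (S (f k)) (T (g k)))"
proof -
  have "finite {i. (case i of (u, v) \<Rightarrow> packed u \<and> packed v) \<and> tens (f k) (g k) i \<noteq> 0}" if "k \<in> K" for k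
  proof (rule finite_subset)
    show "{i. (case i of (u, v) \<Rightarrow> packed u \<and> packed v) \<and> tens (f k) (g k) i \<noteq> 0} \<subseteq>
        {u. packed u \<and> f k u \<noteq> 0} \<times> {u. packed u \<and> g k u \<noteq> 0}"
      by (auto simp: tens_def)
  qed (use fg that in \<open>simp add: finite_packed_support\<close>)
  then have "tensor_map S T (\<Sum>k\<in>K. tens (f k) (g k)) = (\<Sum>k\<in>K. tensor_map S T (tens (f k) (g k)))"
    unfolding tensor_map_def using assms(3) by (rule lin_ext_sum[rotated])
  then show ?thesis using assms by (simp add: tensor_map_tens)
qed

section \<open>Letter intervals of packed words and convolution\<close>

text \<open>The half-open convention makes consecutive intervals share an end point: cutting at
  \<open>k\<close> in the coproduct of \<open>M u\<close> yields \<open>block u 0 k\<close> and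
  \<open>block u k n\<close> with \<open>n\<close> the largest letter.\<close>

definition block :: "nat list \<Rightarrow> nat \<Rightarrow> nat \<Rightarrow> nat list" where
  "block u i j = pack (restr u {i + 1..j})"

lemma set_restr [simp]: "set (restr u A) = set u \<inter> A"
  by (auto simp: restr_def)

lemma restr_restr: "restr (restr u A) B = restr u (A \<inter> B)"
  by (simp add: restr_def)

lemma packed_block [simp]: "packed (block u i j)"
  by (simp add: block_def)

lemma packed_Nil [simp]: "packed []"
  by (simp add: packed_def)

lemma max_letter_Nil [simp]: "max_letter [] = 0"
  by (simp add: max_letter_def)

lemma max_letter_eq_0_iff: "packed u \<Longrightarrow> max_letter u = 0 \<longleftrightarrow> u = []"
  by (auto simp: packed_iff)

lemma M_Nil: "M [] = unit_series"
  by (rule ext) (auto simp: M_def unit_series_def pack_def is_word_def)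

lemma set_restr_interval:
  "packed u \<Longrightarrow> j \<le> max_letter u \<Longrightarrow> set (restr u {i + 1..j}) = {i + 1..j}"
  by (auto simp: packed_iff)

lemma pack_shift: "set w \<subseteq> {i + 1..} \<Longrightarrow> pack (map (\<lambda>a. a - i) w) = pack w"
  by (rule pack_map) (fastforce intro!: strict_mono_onI)

lemma pack_interval:
  assumes "set w = {i + 1..j}" shows "pack w = map (\<lambda>a. a - i) w"
proof -
  have "(\<lambda>a. a - i) ` {i + 1..j} = {1..j - i}"
    by (auto simp: image_iff intro!: bexI[of _ "_ + i"])
  then have "packed (map (\<lambda>a. a - i) w)" using assms by (intro packedI[of _ "j - i"]) simp
  then show ?thesis using pack_shift[of w i] assms by (simp add: packed_def)
qed

lemma pack_restr_shift:
  assumes "set w \<subseteq> {i + 1..}"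
  shows "pack (restr (map (\<lambda>a. a - i) w) {k + 1..l}) = pack (restr w {i + k + 1..i + l})"
proof -
  have "restr (map (\<lambda>a. a - i) w) {k + 1..l} = map (\<lambda>a. a - i) (restr w {i + k + 1..i + l})"
    using assms unfolding restr_def filter_map by (intro arg_cong[where f = "map _"] filter_cong) auto
  then show ?thesis using assms by (simp add: pack_shift subset_iff)
qed

lemma max_letter_block:
  assumes "packed u" "j \<le> max_letter u" shows "max_letter (block u i j) = j - i"
  using set_restr_interval[OF assms, of i] by (simp add: block_def max_letter_pack del: set_restr)

text \<open>For packed \<open>u\<close>, passing to \<open>block u i j\<close> shifts the letters
  down by \<open>i\<close>, so an interval of the block comes from an interval of \<open>u\<close>
  lying higher by \<open>i\<close>. This is what coassociativity amounts to on the basis.\<close>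

lemma block_block:
  assumes u: "packed u" "j \<le> max_letter u" and l: "i + l \<le> j"
  shows "block (block u i j) k l = block u (i + k) (i + l)"
proof -
  have "block u i j = map (\<lambda>a. a - i) (restr u {i + 1..j})"
    unfolding block_def by (rule pack_interval[OF set_restr_interval[OF u]])
  then have "block (block u i j) k l = pack (restr (restr u {i + 1..j}) {i + k + 1..i + l})"
    unfolding block_def[of _ k l] by (simp only:) (rule pack_restr_shift, auto)
  also have "{i + 1..j} \<inter> {i + k + 1..i + l} = {i + k + 1..i + l}" using l by auto
  then have "pack (restr (restr u {i + 1..j}) {i + k + 1..i + l}) = block u (i + k) (i + l)"
    by (simp only: block_def restr_restr)
  finally show ?thesis .
qed

lemma restr_eq_block:
  assumes "packed u" "k \<le> max_letter u" shows "restr u {1..k} = block u 0 k"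
proof -
  have "packed (restr u {1..k})" using set_restr_interval[OF assms, of 0] by (intro packedI[of _ k]) simp
  then show ?thesis by (simp add: block_def packed_def)
qed

lemma block_full: "packed u \<Longrightarrow> block u 0 (max_letter u) = u"
  using packed_iff[of u] by (simp flip: restr_eq_block add: restr_def filter_id_conv)

lemma block_empty: "block u j j = []"
  by (simp add: block_def restr_def)

lemma block_eq_Nil_iff:
  assumes "packed u" "j \<le> max_letter u" shows "block u i j = [] \<longleftrightarrow> j \<le> i"
  using max_letter_eq_0_iff[of "block u i j"] max_letter_block[OF assms, of i] by simp

lemma Delta_basis_block:
  assumes "packed u"
  shows "Delta_basis u = (\<Sum>k = 0..max_letter u. tens (M (block u 0 k)) (M (block u k (max_letter u))))"
  unfolding Delta_basis_def by (intro sum.cong refl) (simp only: restr_eq_block[OF assms] block_def[of u _ "max_letter u"] atLeastAtMost_iff)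

lemma convolution_M:
  assumes "linear_on_WQSym S" "linear_on_WQSym T" "packed u"
  shows "convolution S T (M u) = (\<Sum>k = 0..max_letter u. mult (S (M (block u 0 k))) (T (M (block u k (max_letter u)))))"
  using assms unfolding convolution_def
  by (simp add: Delta_M Delta_basis_block tensor_map_sum_tens M_in_WQSym mult2_sum_tens)

text \<open>Reduces the antipode axioms to the basis. \<open>Delta f\<close> is written as one
  finite sum of pure tensors, indexed by a word of the support and a cut, with the coefficient
  absorbed in the left factor, so that \<open>tensor_map_sum_tens\<close> applies.\<close>

lemma convolution_expand:
  assumes S: "linear_on_WQSym S" and T: "linear_on_WQSym T" and f: "f \<in> WQSym"
  shows "convolution S T f = lin_ext packed (\<lambda>u. convolution S T (M u)) f"
proof -
  let ?A = "{u. packed u \<and> f u \<noteq> 0}"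
  let ?D = "SIGMA u:?A. {0..max_letter u}"
  have fin: "finite ?A" using f by (rule finite_packed_support)
  have scale_tens: "fscale c (tens g h) = tens (fscale c g) h" for c and g h :: "'a series"
    by (auto simp: fscale_def tens_def fun_eq_iff)
  have "Delta f = (\<Sum>u\<in>?A. \<Sum>k = 0..max_letter u.
      tens (fscale (f u) (M (block u 0 k))) (M (block u k (max_letter u))))"
    unfolding Delta_def lin_ext_def
    by (intro sum.cong refl) (simp add: Delta_basis_block fun_space.scale_sum_right scale_tens)
  also have "\<dots> = (\<Sum>(u, k)\<in>?D. tens (fscale (f u) (M (block u 0 k))) (M (block u k (max_letter u))))"
    using fin by (intro sum.Sigma) auto
  finally have "tensor_map S T (Delta f) =
      (\<Sum>x\<in>?D. tens (S (fscale (f (fst x)) (M (block (fst x) 0 (snd x)))))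
        (T (M (block (fst x) (snd x) (max_letter (fst x))))))"
    using fin unfolding case_prod_beta
    by (simp only:) (rule tensor_map_sum_tens[OF S T],
      auto intro!: M_in_WQSym fun_space.subspace_scale[OF subspace_WQSym])
  then have "convolution S T f = (\<Sum>x\<in>?D. mult (S (fscale (f (fst x)) (M (block (fst x) 0 (snd x)))))
        (T (M (block (fst x) (snd x) (max_letter (fst x))))))"
    by (simp only: convolution_def mult2_sum_tens)
  also have "\<dots> = (\<Sum>(u, k)\<in>?D. fscale (f u) (mult (S (M (block u 0 k))) (T (M (block u k (max_letter u))))))"
    using S by (intro sum.cong) (auto simp: linear_on_WQSym_def M_in_WQSym mult_fscale_left)
  also have "\<dots> = (\<Sum>u\<in>?A. \<Sum>k = 0..max_letter u. fscale (f u) (mult (S (M (block u 0 k))) (T (M (block u k (max_letter u))))))"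
    using fin by (intro sum.Sigma[symmetric]) auto
  also have "\<dots> = lin_ext packed (\<lambda>u. convolution S T (M u)) f"
    unfolding lin_ext_def using S T
    by (intro sum.cong refl) (simp add: convolution_M fun_space.scale_sum_right)
  finally show ?thesis .
qed

section \<open>Recursive left and right inverses of the identity\<close>

text \<open>Arbitrary words are covered because the termination proofs below concern all arguments,
  packed or not.\<close>

lemma max_letter_block_le: "max_letter (block u i j) \<le> j - i"
proof -
  have "card (set u \<inter> {i + 1..j}) \<le> card {i + 1..j}" by (intro card_mono) auto
  then show ?thesis by (simp add: block_def max_letter_pack)
qed

text \<open>For packed \<open>u\<close>, the value of the antipode at \<open>M u\<close>, solved
  from the left axiom: the cut at \<open>max_letter u\<close> has the unknown as left factor and the
  unit \<open>M []\<close> as right factor, and the smaller cuts are moved to the other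
  side.\<close>

function left_antipode :: "nat list \<Rightarrow> 'k::field series" where
  "left_antipode u = (if u = [] then unit_series else
     - (\<Sum>k\<in>{0..<max_letter u}. mult (left_antipode (block u 0 k)) (M (block u k (max_letter u)))))"
  by auto
termination
  by (relation "measure max_letter") (auto intro: le_less_trans[OF max_letter_block_le])

text \<open>The mirror image, solved from the right axiom, where the cut at 0 isolates the
  unknown.\<close>

function right_antipode :: "nat list \<Rightarrow> 'k::field series" where
  "right_antipode u = (if u = [] then unit_series else
     - (\<Sum>k\<in>{1..max_letter u}. mult (M (block u 0 k)) (right_antipode (block u k (max_letter u)))))"
  by auto
termination
  by (relation "measure max_letter") (auto intro: le_less_trans[OF max_letter_block_le])

declare left_antipode.simps [simp del] right_antipode.simps [simp del]

lemma left_antipode_sum: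
  assumes "packed u"
  shows "(\<Sum>k = 0..max_letter u. mult (left_antipode (block u 0 k)) (M (block u k (max_letter u)))) =
    (if u = [] then unit_series else (0 :: 'k::field series))"
proof (cases "u = []")
  case True
  then show ?thesis by (simp add: block_empty M_Nil mult_unit_right left_antipode.simps)
next
  case False
  have "{0..max_letter u} = insert (max_letter u) {0..<max_letter u}" by auto
  then show ?thesis
    using False assms by (simp add: block_full block_empty M_Nil mult_unit_right left_antipode.simps[of u])
qed

lemma right_antipode_sum:
  assumes "packed u"
  shows "(\<Sum>k = 0..max_letter u. mult (M (block u 0 k)) (right_antipode (block u k (max_letter u)))) =
    (if u = [] then unit_series else (0 :: 'k::field series))"
proof (cases "u = []")
  case True
  then show ?thesis by (simp add: block_empty M_Nil mult_unit_left right_antipode.simps)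
next
  case False
  have "{0..max_letter u} = insert 0 {1..max_letter u}" by auto
  then show ?thesis
    using False assms by (simp add: block_full block_empty M_Nil mult_unit_left right_antipode.simps[of u])
qed

text \<open>The usual argument that a left and a right inverse for convolution agree; coassociativity
  enters as the lemma \<open>block_block\<close>.\<close>

lemma left_antipode_eq_right_antipode:
  assumes u: "packed u"
  shows "left_antipode u = (right_antipode u :: 'k::field series)"
proof -
  let ?n = "max_letter u"
  define l where "l i = (left_antipode (block u 0 i) :: 'k series)" for i
  define I where "I i j = (M (block u i j) :: 'k series)" for i j
  define r where "r j = (right_antipode (block u j ?n) :: 'k series)" for j
  \<comment> \<open>The identity for \<open>left_antipode\<close> at the packed word
    \<open>block u 0 j\<close>, with inner blocks rewritten as blocks of \<open>u\<close>.\<close>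
  have left: "(\<Sum>i = 0..j. mult (l i) (I i j)) = (if j = 0 then unit_series else 0)" if j: "j \<le> ?n" for j
  proof -
    have "(\<Sum>i = 0..j. mult (left_antipode (block (block u 0 j) 0 i)) (M (block (block u 0 j) i j) :: 'k series)) =
        (if j = 0 then unit_series else 0)"
      using left_antipode_sum[of "block u 0 j"] by (simp add: max_letter_block[OF u j] block_eq_Nil_iff[OF u j])
    then show ?thesis using j u by (simp add: block_block l_def I_def)
  qed
  \<comment> \<open>The identity for \<open>right_antipode\<close> at \<open>block u i ?n\<close>;
    its cuts \<open>k\<close> become the cuts \<open>j = i + k\<close> of \<open>u\<close>.\<close>
  have right: "(\<Sum>j = i..?n. mult (I i j) (r j)) = (if i = ?n then unit_series else 0)" if i: "i \<le> ?n" for i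
  proof -
    have "(\<Sum>k = 0..?n - i. mult (M (block (block u i ?n) 0 k)) (right_antipode (block (block u i ?n) k (?n - i)) :: 'k series)) =
        (if ?n \<le> i then unit_series else 0)"
      using right_antipode_sum[OF packed_block[of u i ?n]]
      by (simp only: max_letter_block[OF u order_refl] block_eq_Nil_iff[OF u order_refl])
    moreover have "(\<Sum>k = 0..?n - i. mult (M (block (block u i ?n) 0 k)) (right_antipode (block (block u i ?n) k (?n - i)) :: 'k series)) =
        (\<Sum>k = 0..?n - i. mult (I i (i + k)) (r (i + k)))"
      using i u by (intro sum.cong refl) (simp add: block_block I_def r_def)
    moreover have "\<dots> = (\<Sum>j = i..?n. mult (I i j) (r j))"
      by (subst sum.atLeastAtMost_shift_0[OF i]) (simp add: comp_def)
    ultimately show ?thesis using i by simp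
  qed
  have "right_antipode u = r 0" by (simp add: r_def block_full[OF u])
  also have "\<dots> = (\<Sum>j\<in>{0..?n}. if j = 0 then r 0 else 0)" by simp
  also have "\<dots> = (\<Sum>j\<in>{0..?n}. mult (\<Sum>i = 0..j. mult (l i) (I i j)) (r j))"
    by (intro sum.cong refl) (simp add: left mult_unit_left mult_zero_left)
  also have "\<dots> = (\<Sum>j\<in>{0..?n}. \<Sum>i\<in>{i. i \<in> {0..?n} \<and> i \<le> j}. mult (l i) (mult (I i j) (r j)))"
    unfolding mult_sum_left mult_assoc_series by (intro sum.cong refl) auto
  also have "\<dots> = (\<Sum>i\<in>{0..?n}. \<Sum>j\<in>{j. j \<in> {0..?n} \<and> i \<le> j}. mult (l i) (mult (I i j) (r j)))"
    by (rule sum.swap_restrict) auto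
  also have "\<dots> = (\<Sum>i\<in>{0..?n}. mult (l i) (\<Sum>j = i..?n. mult (I i j) (r j)))"
    unfolding mult_sum_right by (intro sum.cong refl) auto
  also have "\<dots> = (\<Sum>i\<in>{0..?n}. if i = ?n then l ?n else 0)"
    by (intro sum.cong refl) (simp add: right mult_unit_right mult_zero_right)
  also have "\<dots> = left_antipode u" by (simp add: l_def block_full[OF u])
  finally show ?thesis by simp
qed

lemma left_antipode_in_WQSym: "packed u \<Longrightarrow> left_antipode u \<in> (WQSym :: 'k::field series set)"
proof (induction u rule: left_antipode.induct)
  case (1 u)
  show ?case
  proof (cases "u = []")
    case True
    then show ?thesis using M_in_WQSym[of "[]"] by (simp add: M_Nil left_antipode.simps)
  next
    case False
    then have "mult (left_antipode (block u 0 k)) (M (block u k (max_letter u))) \<in> (WQSym :: 'k series set)" if "k \<in> {0..<max_letter u}" for k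
      using 1 that by (intro mult_WQSym M_in_WQSym) auto
    then show ?thesis
      using False by (subst left_antipode.simps) (auto intro!: fun_space.subspace_neg fun_space.subspace_sum subspace_WQSym)
  qed
qed

lemma counit_expand:
  assumes "f \<in> WQSym"
  shows "lin_ext packed (\<lambda>u. if u = [] then unit_series else 0) f = fscale (counit f) unit_series"
proof -
  have "lin_ext packed (\<lambda>u. if u = [] then unit_series else 0) f =
      (\<Sum>u\<in>{u. packed u \<and> f u \<noteq> 0}. if u = [] then fscale (f []) unit_series else 0)"
    unfolding lin_ext_def by (intro sum.cong) auto
  also have "\<dots> = fscale (counit f) unit_series"
    using finite_packed_support[OF assms] by (simp add: counit_def)
  finally show ?thesis .
qed

text \<open>Both axioms are checked on the basis, where the left one is the recursion and the right
  one follows since the left and right solutions agree.\<close>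

lemma antipode_exists: "\<exists>S :: 'k::field series \<Rightarrow> 'k series. is_antipode S"
proof
  let ?S = "lin_ext packed left_antipode :: 'k series \<Rightarrow> 'k series"
  note lin = linear_on_WQSym_lin_ext[of "left_antipode :: nat list \<Rightarrow> 'k series"]
  have S: "?S (M u) = left_antipode u" if "packed u" for u using that by (rule lin_ext_M)
  have left: "convolution ?S id (M u) = (if u = [] then unit_series else 0)" if "packed u" for u
    using that left_antipode_sum[OF that] by (simp add: convolution_M lin linear_on_WQSym_id S)
  have right: "convolution id ?S (M u) = (if u = [] then unit_series else 0)" if "packed u" for u
    using that right_antipode_sum[OF that, where ?'k = 'k]
    by (simp add: convolution_M lin linear_on_WQSym_id S left_antipode_eq_right_antipode)
  have cong: "lin_ext packed b f = lin_ext packed b' f" if "\<And>u. packed u \<Longrightarrow> b u = b' u"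
    for b b' :: "nat list \<Rightarrow> 'k series" and f
    unfolding lin_ext_def using that by (intro sum.cong) auto
  show "is_antipode ?S"
    unfolding is_antipode_def
  proof (intro conjI ballI)
    show "?S ` WQSym \<subseteq> WQSym"
      by (intro image_subsetI lin_ext_in_subspace[OF subspace_WQSym] left_antipode_in_WQSym)
    fix f :: "'k series" assume f: "f \<in> WQSym"
    show "convolution ?S id f = fscale (counit f) unit_series"
      using cong[OF left] f by (simp add: convolution_expand lin linear_on_WQSym_id counit_expand)
    show "convolution id ?S f = fscale (counit f) unit_series"
      using cong[OF right] f by (simp add: convolution_expand lin linear_on_WQSym_id counit_expand)
  qed (rule lin)
qed

section \<open>The coproduct\<close>

lemma zip_filter_filter:
  assumes "list_all2 (\<lambda>a b. P a \<longleftrightarrow> Q b) x y"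
  shows "length (filter P x) = length (filter Q y) \<and>
    zip (filter P x) (filter Q y) = filter (\<lambda>(a, b). P a) (zip x y)"
  using assms by (induction rule: list_all2_induct) auto

lemma list_all2_not: "list_all2 (\<lambda>a b. P a \<longleftrightarrow> Q b) x y \<Longrightarrow> list_all2 (\<lambda>a b. \<not> P a \<longleftrightarrow> \<not> Q b) x y"
  by simp

lemma order_equiv_filter:
  assumes "order_equiv x y" "list_all2 (\<lambda>a b. P a \<longleftrightarrow> Q b) x y"
  shows "order_equiv (filter P x) (filter Q y)"
  using assms zip_filter_filter[OF assms(2)] by (simp add: order_equiv_iff_zip sorted_wrt_filter)

lemma sorted_wrt_by_filter:
  assumes "sorted_wrt R (filter P xs)" "sorted_wrt R (filter (\<lambda>x. \<not> P x) xs)"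
    and "\<And>x y. x \<in> set xs \<Longrightarrow> y \<in> set xs \<Longrightarrow> P x \<noteq> P y \<Longrightarrow> R x y"
  shows "sorted_wrt R xs"
  using assms
proof (induction xs)
  case (Cons a xs)
  have "R a y" if "y \<in> set xs" for y
    using Cons.prems that by (cases "P a = P y") (auto split: if_splits)
  moreover have "sorted_wrt R xs"
    using Cons.prems by (intro Cons.IH) (auto split: if_splits)
  ultimately show ?case by simp
qed simp

text \<open>A converse of \<open>order_equiv_filter\<close> for threshold cuts: positions on
  opposite sides of the thresholds compare the same way in both words, because the thresholds select
  the same positions.\<close>

lemma order_equiv_by_filter:
  assumes cut: "list_all2 (\<lambda>a b. a \<le> k \<longleftrightarrow> b \<le> l) x y"
    and low: "order_equiv (filter (\<lambda>a. a \<le> k) x) (filter (\<lambda>b. b \<le> l) y)"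
    and high: "order_equiv (filter (\<lambda>a. \<not> a \<le> k) x) (filter (\<lambda>b. \<not> b \<le> l) y)"
  shows "order_equiv x y"
proof -
  have mask: "a \<le> k \<longleftrightarrow> b \<le> l" if "(a, b) \<in> set (zip x y)" for a b
    using cut that by (auto simp: list_all2_iff)
  have "sorted_wrt (\<lambda>(a, b) (c, d). a \<le> c \<longleftrightarrow> b \<le> d) (zip x y)"
  proof (rule sorted_wrt_by_filter[where P = "\<lambda>(a, b). a \<le> k"])
    show "sorted_wrt (\<lambda>(a, b) (c, d). a \<le> c \<longleftrightarrow> b \<le> d) (filter (\<lambda>(a, b). a \<le> k) (zip x y))"
      using low zip_filter_filter[OF cut] by (simp add: order_equiv_iff_zip)
    show "sorted_wrt (\<lambda>(a, b) (c, d). a \<le> c \<longleftrightarrow> b \<le> d) (filter (\<lambda>p. \<not> (case p of (a, b) \<Rightarrow> a \<le> k)) (zip x y))"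
      using high zip_filter_filter[OF list_all2_not[OF cut]] by (simp add: order_equiv_iff_zip case_prod_unfold)
    fix p q assume pq: "p \<in> set (zip x y)" "q \<in> set (zip x y)"
      "(case p of (a, b) \<Rightarrow> a \<le> k) \<noteq> (case q of (a, b) \<Rightarrow> a \<le> k)"
    obtain a b c d where "p = (a, b)" "q = (c, d)" by (metis prod.exhaust)
    then show "(case p of (a, b) \<Rightarrow> \<lambda>(c, d). a \<le> c \<longleftrightarrow> b \<le> d) q"
      using pq mask[of a b] mask[of c d] by auto
  qed
  then show ?thesis using cut by (simp add: order_equiv_iff_zip list_all2_lengthD)
qed

text \<open>The common mask tells, letter by letter, from which of the two subwords the next letter
  is taken.\<close>

lemma filter_cut_unique:
  assumes "list_all2 (\<lambda>a b. P a \<longleftrightarrow> P b) x y" "filter P x = filter P y"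
    "filter (\<lambda>a. \<not> P a) x = filter (\<lambda>a. \<not> P a) y"
  shows "x = y"
  using assms by (induction rule: list_all2_induct) (auto split: if_splits)

lemma filter_cut_exists:
  assumes "length x = length (filter Q z)" "length y = length (filter (\<lambda>b. \<not> Q b) z)"
    "\<forall>a\<in>set x. P a" "\<forall>a\<in>set y. \<not> P a"
  shows "\<exists>u. list_all2 (\<lambda>a b. P a \<longleftrightarrow> Q b) u z \<and> filter P u = x \<and> filter (\<lambda>a. \<not> P a) u = y"
  using assms
proof (induction z arbitrary: x y)
  case (Cons b z)
  show ?case
  proof (cases "Q b")
    case True
    then obtain a x' where x: "x = a # x'" using Cons.prems by (cases x) auto
    then obtain u where "list_all2 (\<lambda>a b. P a \<longleftrightarrow> Q b) u z" "filter P u = x'" "filter (\<lambda>a. \<not> P a) u = y"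
      using Cons.IH[of x' y] Cons.prems True by auto
    then show ?thesis using x True Cons.prems by (intro exI[of _ "a # u"]) auto
  next
    case False
    then obtain a y' where y: "y = a # y'" using Cons.prems by (cases y) auto
    then obtain u where "list_all2 (\<lambda>a b. P a \<longleftrightarrow> Q b) u z" "filter P u = x" "filter (\<lambda>a. \<not> P a) u = y'"
      using Cons.IH[of x y'] Cons.prems False by auto
    then show ?thesis using y False Cons.prems by (intro exI[of _ "a # u"]) auto
  qed
qed simp

lemma count_list_filter: "count_list (filter P w) a = (if P a then count_list w a else 0)"
  by (induction w) auto

lemma is_word_filter: "is_word w \<Longrightarrow> is_word (filter P w)"
  by (simp add: is_word_def)

lemma m_word_filter: "m_word m w \<Longrightarrow> m_word m (filter P w)"
  by (simp add: m_word_def count_list_filter is_word_filter)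

text \<open>A filter keeps or drops all occurrences of a letter together, so each letter is counted
  in full in one of the two parts.\<close>

lemma m_word_by_filter:
  assumes "m_word m (filter P w)" "m_word m (filter (\<lambda>a. \<not> P a) w)"
  shows "m_word m w"
proof -
  have "1 \<le> a" if "a \<in> set w" for a
    using assms that by (cases "P a") (auto simp: m_word_def is_word_def)
  moreover have "m dvd count_list (filter P w) a" "m dvd count_list (filter (\<lambda>a. \<not> P a) w) a" for a
    using assms by (simp_all add: m_word_def)
  then have "m dvd count_list w a" for a
    unfolding count_list_filter by (metis (full_types))
  ultimately show ?thesis by (simp add: m_word_def is_word_def)
qed

lemma m_perms_restr:
  assumes "\<alpha> \<in> m_perms m n"
  shows "restr \<alpha> {1..k} = filter (\<lambda>a. a \<le> k) \<alpha>" "restr \<alpha> {k + 1..n} = filter (\<lambda>a. \<not> a \<le> k) \<alpha>"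
  using assms unfolding restr_def by (auto simp: m_perms_def intro!: filter_cong)

lemma packed_block_eq_filter:
  assumes "packed u"
  shows "block u 0 k = pack (filter (\<lambda>a. a \<le> k) u)" "block u k (max_letter u) = pack (filter (\<lambda>a. \<not> a \<le> k) u)"
  using assms unfolding block_def restr_def packed_iff
  by (auto intro!: arg_cong[where f = pack] filter_cong)

text \<open>The letters up to \<open>k\<close> occupy an initial segment of the ranking whose size
  is a multiple of \<open>m\<close>, so they receive exactly the labels up to that size divided by
  \<open>m\<close>.\<close>

lemma m_word_letter_cut:
  assumes "m \<ge> 1" "m_word m u"
  shows "list_all2 (\<lambda>a b. a \<le> k \<longleftrightarrow> b \<le> length (filter (\<lambda>a. a \<le> k) u) div m) u (std m u)"
proof -
  have "length (filter (\<lambda>a. a \<le> k) u) = card {i. i < length u \<and> u ! i < Suc k}"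
    by (simp add: length_filter_conv_card less_Suc_eq_le)
  then show ?thesis
    using rank_div_less_letter_iff[OF assms, of _ "Suc k"] assms
    by (auto simp: list_all2_conv_all_nth std_nth Suc_le_eq less_Suc_eq_le)
qed

text \<open>Turns a count with at most one solution into an existence statement, the form in which
  the two sides of the coproduct formula are compared.\<close>

lemma sum_indicator_unique:
  assumes "finite A" "\<And>x y. x \<in> A \<Longrightarrow> y \<in> A \<Longrightarrow> Q x \<Longrightarrow> Q y \<Longrightarrow> x = y"
  shows "(\<Sum>x\<in>A. if Q x then 1 else 0) = (if \<exists>x\<in>A. Q x then 1 else 0 :: 'k::field)"
proof (cases "\<exists>x\<in>A. Q x")
  case True
  then obtain a where a: "a \<in> A" "Q a" by blast
  then have "Q x \<longleftrightarrow> x = a" if "x \<in> A" for x using assms(2)[of x a] that by blast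
  then have "(\<Sum>x\<in>A. if Q x then 1 else 0) = (\<Sum>x\<in>A. if x = a then 1 else 0 :: 'k)"
    by (intro sum.cong) auto
  then show ?thesis using assms(1) a True by simp
qed simp

lemma restr_std_in_m_perms:
  assumes m: "m \<ge> 1" and \<alpha>: "\<alpha> \<in> m_perms m n" and k: "k \<le> n"
  shows "std m (restr \<alpha> {1..k}) \<in> m_perms m k" "std m (restr \<alpha> {k + 1..n}) \<in> m_perms m (n - k)"
proof -
  have low: "length (filter (\<lambda>a. a \<le> k) \<alpha>) = m * k"
    using card_m_perms_le[OF \<alpha> k] by (simp add: length_filter_conv_card)
  then have high: "length (filter (\<lambda>a. \<not> a \<le> k) \<alpha>) = m * (n - k)"
    using sum_length_filter_compl[of "\<lambda>a. a \<le> k" \<alpha>] length_m_perms[OF \<alpha>] by (simp add: diff_mult_distrib2)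
  show "std m (restr \<alpha> {1..k}) \<in> m_perms m k" "std m (restr \<alpha> {k + 1..n}) \<in> m_perms m (n - k)"
    unfolding m_perms_restr[OF \<alpha>] by (intro std_in_m_perms m m_word_filter m_perms_m_word[OF \<alpha>] low high)+
qed

text \<open>At \<open>(v, w)\<close> the left side counts the pairs \<open>(u, k)\<close> in
  \<open>?D\<close> satisfying \<open>Q\<close> and the right side counts the cuts \<open>l\<close>
  satisfying \<open>R\<close>. Each count is at most 1, and a solution on either side yields one on
  the other.\<close>

lemma Delta_G:
  assumes m: "m \<ge> 1" and \<alpha>: "\<alpha> \<in> m_perms m n"
  shows "Delta (G m \<alpha>) = (\<Sum>k = 0..n.
    tens (G m (std m (restr \<alpha> {1..k}))) (G m (std m (restr \<alpha> {k + 1..n}))) :: 'k::field series2)"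
proof
  fix x :: "nat list \<times> nat list"
  obtain v w where x: "x = (v, w)" by (cases x)
  define U where "U = {u. packed u \<and> m_word m u \<and> std m u = \<alpha>}"
  have U: "{u. packed u \<and> G m \<alpha> u \<noteq> (0 :: 'k)} = U" by (auto simp: U_def G_def)
  have finU: "finite U" unfolding U[symmetric] by (intro finite_packed_support G_in_WQSym[OF m \<alpha>])
  define Q where "Q p \<longleftrightarrow> is_word v \<and> is_word w \<and> pack v = pack (filter (\<lambda>a. a \<le> snd p) (fst p)) \<and>
    pack w = pack (filter (\<lambda>a. \<not> a \<le> snd p) (fst p))" for p :: "nat list \<times> nat"
  define R where "R l \<longleftrightarrow> m_word m v \<and> m_word m w \<and> std m v = std m (filter (\<lambda>a. a \<le> l) \<alpha>) \<and>
    std m w = std m (filter (\<lambda>a. \<not> a \<le> l) \<alpha>)" for l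
  let ?D = "SIGMA u:U. {0..max_letter u}"
  have QD: "packed u" "m_word m u" "std m u = \<alpha>" "k \<le> max_letter u" if "(u, k) \<in> ?D" for u k
    using that by (auto simp: U_def)
  \<comment> \<open>For packed \<open>u\<close> the letters up to \<open>k\<close> already form a
    packed word, so no letter is renamed and \<open>k\<close> is read off from
    \<open>v\<close>.\<close>
  have low: "filter (\<lambda>a. a \<le> k) u = pack v" and k: "k = max_letter (pack v)"
    if D: "(u, k) \<in> ?D" and q: "Q (u, k)" for u k
  proof -
    have "restr u {1..k} = block u 0 k" by (rule restr_eq_block[OF QD(1,4)[OF D]])
    moreover have "restr u {1..k} = filter (\<lambda>a. a \<le> k) u"
      using packed_imp_is_word[OF QD(1)[OF D]] unfolding restr_def by (intro filter_cong) (auto simp: is_word_def)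
    moreover have "pack v = block u 0 k"
      using q packed_block_eq_filter(1)[OF QD(1)[OF D]] by (simp add: Q_def)
    ultimately show "filter (\<lambda>a. a \<le> k) u = pack v" "k = max_letter (pack v)"
      using max_letter_block[OF QD(1,4)[OF D], of 0] by simp_all
  qed
  \<comment> \<open>The upper letters fill the interval after \<open>k\<close>, so packing them
    subtracts \<open>k\<close> and is undone by adding it.\<close>
  have high: "filter (\<lambda>a. \<not> a \<le> k) u = map (\<lambda>a. a + k) (pack w)"
    if D: "(u, k) \<in> ?D" and q: "Q (u, k)" for u k
  proof -
    have "set (filter (\<lambda>a. \<not> a \<le> k) u) = {k + 1..max_letter u}"
      using QD(1)[OF D] by (auto simp: packed_iff)
    then have "pack (filter (\<lambda>a. \<not> a \<le> k) u) = map (\<lambda>a. a - k) (filter (\<lambda>a. \<not> a \<le> k) u)"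
      by (rule pack_interval)
    then have "pack w = map (\<lambda>a. a - k) (filter (\<lambda>a. \<not> a \<le> k) u)"
      using q by (simp add: Q_def)
    then have "map (\<lambda>a. a + k) (pack w) = map (\<lambda>a. a - k + k) (filter (\<lambda>a. \<not> a \<le> k) u)"
      by (simp add: comp_def)
    also have "\<dots> = filter (\<lambda>a. \<not> a \<le> k) u" by (rule map_idI) auto
    finally show ?thesis by simp
  qed
  \<comment> \<open>The mask of the low letters is dictated by \<open>\<alpha>\<close> and
    \<open>length v\<close> alone, which is the key to the uniqueness of \<open>u\<close>.\<close>
  have cut: "list_all2 (\<lambda>a b. a \<le> k \<longleftrightarrow> b \<le> length v div m) u \<alpha>"
    if D: "(u, k) \<in> ?D" and q: "Q (u, k)" for u k
    using m_word_letter_cut[OF m QD(2)[OF D], of k] low[OF that] QD(3)[OF D] by simp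
  have uniqueQ: "p = p'" if p: "p \<in> ?D" "p' \<in> ?D" "Q p" "Q p'" for p p'
  proof -
    obtain u k u' k' where e: "p = (u, k)" "p' = (u', k')" by (metis prod.exhaust)
    have k': "k' = k" using k p unfolding e by metis
    have "list_all2 (\<lambda>a b. a \<le> k \<longleftrightarrow> b \<le> k) u u'"
      using cut[of u k] cut[of u' k'] p unfolding e k' by (auto simp: list_all2_conv_all_nth)
    then have "u = u'"
      by (rule filter_cut_unique) (use low high p in \<open>simp_all add: e k'\<close>)
    then show ?thesis by (simp add: e k')
  qed
  have uniqueR: "l = l'" if "l \<in> {0..n}" "l' \<in> {0..n}" "R l" "R l'" for l l'
  proof -
    have "length v = m * i" if "i \<in> {0..n}" "R i" for i
    proof -
      have "length v = length (filter (\<lambda>a. a \<le> i) \<alpha>)"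
        using that(2) unfolding R_def by (metis length_std)
      then show ?thesis using card_m_perms_le[OF \<alpha>, of i] that(1) by (simp add: length_filter_conv_card)
    qed
    then show ?thesis using that m by (metis mult_cancel1 not_one_le_zero)
  qed
  have QR: "\<exists>l\<in>{0..n}. R l" if D: "p \<in> ?D" and q: "Q p" for p
  proof -
    obtain u k where e: "p = (u, k)" by (cases p)
    \<comment> \<open>The low part of \<open>u\<close> has \<open>length v\<close> letters, in
      groups of \<open>m\<close>, so \<open>?l\<close> is its largest label.\<close>
    let ?l = "length v div m"
    note D = D[unfolded e] and q = q[unfolded e]
    note u = QD[OF D]
    have oe: "order_equiv u \<alpha>" using order_equiv_std_self[OF m u(2)] u(3) order_equiv_sym by simp
    have words: "m_word m (filter P u)" "m_word m (filter P \<alpha>)" for P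
      using u(2) m_perms_m_word[OF \<alpha>] by (auto intro: m_word_filter)
    have mv: "m_word m v" "m_word m w"
      using q words m_word_pack_iff m_word_is_word unfolding Q_def by (metis fst_conv snd_conv)+
    have "std m v = std m (filter (\<lambda>a. a \<le> k) u)" "std m w = std m (filter (\<lambda>a. \<not> a \<le> k) u)"
      using q words mv std_pack[OF m] unfolding Q_def by (metis fst_conv snd_conv)+
    moreover have "std m (filter (\<lambda>a. a \<le> k) u) = std m (filter (\<lambda>a. a \<le> ?l) \<alpha>)"
      by (intro order_equiv_std m words order_equiv_filter oe cut D q)
    moreover have "std m (filter (\<lambda>a. \<not> a \<le> k) u) = std m (filter (\<lambda>a. \<not> a \<le> ?l) \<alpha>)"
      by (intro order_equiv_std m words order_equiv_filter oe list_all2_not cut D q)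
    moreover have "?l \<le> n"
    proof -
      have "length v \<le> m * n"
        using low[OF D q] length_filter_le[of "\<lambda>a. a \<le> k" u] u(3) length_m_perms[OF \<alpha>]
        by (metis length_pack length_std)
      then show ?thesis using m div_le_mono[of "length v" "m * n" m] by simp
    qed
    ultimately show ?thesis using mv by (intro bexI[of _ ?l]) (auto simp: R_def)
  qed
  have RQ: "\<exists>p\<in>?D. Q p" if l: "l \<in> {0..n}" and r: "R l" for l
  proof -
    have mv: "m_word m v" "m_word m w" using r by (auto simp: R_def)
    have vw: "is_word v" "is_word w" using mv m_word_is_word by auto
    \<comment> \<open>The candidate \<open>u\<close> is the shuffle of \<open>pack v\<close> with
      \<open>pack w\<close> shifted above it, placed along the letters of \<open>\<alpha>\<close> up
      to \<open>l\<close>.\<close>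
    let ?k = "max_letter (pack v)" and ?w = "map (\<lambda>a. a + max_letter (pack v)) (pack w)"
    have words: "m_word m (filter P \<alpha>)" for P using m_perms_m_word[OF \<alpha>] by (rule m_word_filter)
    have oe_v: "order_equiv (pack v) (filter (\<lambda>a. a \<le> l) \<alpha>)"
      using r std_eq_iff_order_equiv[OF m mv(1) words] order_equiv_pack order_equiv_trans unfolding R_def by blast
    have shift: "order_equiv ?w (pack w)" by (rule order_equiv_map) (auto intro: strict_mono_onI)
    have oe_w: "order_equiv ?w (filter (\<lambda>a. \<not> a \<le> l) \<alpha>)"
      using r std_eq_iff_order_equiv[OF m mv(2) words] order_equiv_pack[of w] order_equiv_trans shift unfolding R_def by blast
    have setv: "set (pack v) = {1..?k}" using packed_iff[of "pack v"] by simp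
    have setw: "set ?w = {?k + 1..?k + card (set w)}"
      unfolding set_map set_pack by (auto simp: image_iff intro!: bexI[of _ "_ - max_letter (pack v)"])
    have lens: "length (pack v) = length (filter (\<lambda>b. b \<le> l) \<alpha>)" "length ?w = length (filter (\<lambda>b. \<not> b \<le> l) \<alpha>)"
      using oe_v oe_w by (simp_all only: order_equiv_def)
    have lows: "\<forall>a\<in>set (pack v). a \<le> ?k" unfolding setv by simp
    have highs: "\<forall>a\<in>set ?w. \<not> a \<le> ?k" unfolding setw by simp
    obtain u where u: "list_all2 (\<lambda>a b. a \<le> ?k \<longleftrightarrow> b \<le> l) u \<alpha>"
        "filter (\<lambda>a. a \<le> ?k) u = pack v" "filter (\<lambda>a. \<not> a \<le> ?k) u = ?w"
      using filter_cut_exists[of "pack v" "\<lambda>b. b \<le> l" \<alpha> ?w "\<lambda>a. a \<le> ?k"] lens lows highs by blast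
    \<comment> \<open>The letters of the two parts together fill an initial interval, so
      \<open>u\<close> is packed and the cut \<open>?k\<close> lies in its range.\<close>
    have "set u = set (filter (\<lambda>a. a \<le> ?k) u) \<union> set (filter (\<lambda>a. \<not> a \<le> ?k) u)" by auto
    also have "\<dots> = {1..?k + card (set w)}" unfolding u setv setw by auto
    finally have set_u: "set u = {1..?k + card (set w)}" .
    have "is_word ?w" using is_word_pack[of w] by (simp add: is_word_def trans_le_add1)
    then have "m_word m ?w"
      by (subst m_word_map_iff) (use vw mv in \<open>simp_all add: m_word_pack_iff inj_on_def\<close>)
    then have mu: "m_word m u"
      using mv vw m_word_by_filter[of m "\<lambda>a. a \<le> ?k" u] by (simp add: u m_word_pack_iff del: not_le)
    have "order_equiv u \<alpha>" by (rule order_equiv_by_filter[OF u(1)]) (simp_all only: u(2,3) oe_v oe_w)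
    then have "std m u = \<alpha>"
      using order_equiv_std[OF m mu m_perms_m_word[OF \<alpha>]] std_m_perms[OF m \<alpha>] by simp
    then have "(u, ?k) \<in> ?D" using mu packedI[OF set_u] max_letter_eqI[OF set_u] by (simp add: U_def)
    moreover have "pack ?w = pack w" by (subst pack_map) (auto intro: strict_mono_onI)
    then have "Q (u, ?k)" using vw by (simp add: Q_def u del: not_le)
    ultimately show ?thesis by blast
  qed
  have "Delta (G m \<alpha>) x = (\<Sum>u\<in>U. fscale (G m \<alpha> u) (Delta_basis u) :: 'k series2) x"
    unfolding Delta_def lin_ext_def U ..
  also have "\<dots> = (\<Sum>u\<in>U. \<Sum>k = 0..max_letter u. if Q (u, k) then 1 else 0 :: 'k)"
    unfolding sum_apply
  proof (intro sum.cong refl)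
    fix u assume u: "u \<in> U"
    then have "fscale (G m \<alpha> u) (Delta_basis u) x = (Delta_basis u x :: 'k)"
      by (simp add: fscale_def G_def U_def)
    also have "\<dots> = (\<Sum>k = 0..max_letter u. if Q (u, k) then 1 else 0)"
      using u unfolding x by (auto simp: U_def Delta_basis_block packed_block_eq_filter sum_apply tens_def M_def Q_def intro!: sum.cong)
    finally show "fscale (G m \<alpha> u) (Delta_basis u) x = (\<Sum>k = 0..max_letter u. if Q (u, k) then 1 else 0 :: 'k)" .
  qed
  also have "\<dots> = (\<Sum>p\<in>?D. if Q p then 1 else 0)"
    using finU by (subst sum.Sigma) (auto simp: case_prod_unfold)
  also have "\<dots> = (if \<exists>p\<in>?D. Q p then 1 else 0)"
    by (rule sum_indicator_unique) (use finU uniqueQ in auto)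
  also have "\<dots> = (if \<exists>l\<in>{0..n}. R l then 1 else 0)" using QR RQ by auto
  also have "\<dots> = (\<Sum>l = 0..n. if R l then 1 else 0)"
    by (rule sum_indicator_unique[symmetric]) (use uniqueR in auto)
  also have "\<dots> = (\<Sum>k = 0..n. tens (G m (std m (restr \<alpha> {1..k}))) (G m (std m (restr \<alpha> {k + 1..n})))) x"
    unfolding m_perms_restr[OF \<alpha>] x by (auto simp: sum_apply tens_def G_def R_def intro!: sum.cong)
  finally show "Delta (G m \<alpha>) x = (\<Sum>k = 0..n.
    tens (G m (std m (restr \<alpha> {1..k}))) (G m (std m (restr \<alpha> {k + 1..n}))) :: 'k series2) x" .
qed

section \<open>Stability of the span under coproduct and antipode\<close>

lemma subspace_mFQSym_dual: "fun_space.subspace (mFQSym_dual m)"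
  by (simp add: mFQSym_dual_def fun_space.subspace_span)

lemma Nil_in_m_perms: "[] \<in> m_perms m 0"
  by (simp add: m_perms_def)

lemma std_Nil [simp]: "std m [] = []"
  by (simp add: std_def)

lemma G_Nil: "G m [] = unit_series"
  by (rule ext) (auto simp: G_def unit_series_def m_word_def is_word_def dest: arg_cong[where f = length])

lemma unit_in_mFQSym_dual: "unit_series \<in> mFQSym_dual m"
  using G_in_mFQSym_dual[OF Nil_in_m_perms, of m] by (simp add: G_Nil)

text \<open>Membership in \<open>WQSym\<close> is carried through the span induction because
  \<open>Delta\<close> is known to be linear only there.\<close>

lemma Delta_mFQSym_dual:
  assumes m: "m \<ge> 1" and f: "f \<in> (mFQSym_dual m :: 'k::field series set)"
  shows "Delta f \<in> tensor_space (mFQSym_dual m) (mFQSym_dual m)"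
proof -
  let ?T = "tensor_space (mFQSym_dual m) (mFQSym_dual m) :: 'k series2 set"
  have "f \<in> WQSym \<and> Delta f \<in> ?T"
    using f[unfolded mFQSym_dual_def]
  proof (induction rule: fun_space.span_induct_alt)
    case base
    have "Delta (0 :: 'k series) = 0" by (simp add: Delta_def lin_ext_def)
    then have "Delta (0 :: 'k series) \<in> ?T" unfolding tensor_space_def by (simp only: fun_space.span_zero)
    then show ?case using fun_space.subspace_0[OF subspace_WQSym] by (intro conjI)
  next
    case (step c x y)
    then obtain \<alpha> n where x: "x = G m \<alpha>" and \<alpha>: "\<alpha> \<in> m_perms m n" by blast
    have "tens (G m (std m (restr \<alpha> {1..k}))) (G m (std m (restr \<alpha> {k + 1..n}))) \<in> ?T" if "k \<in> {0..n}" for k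
    proof -
      have "k \<le> n" using that by simp
      note restr_std_in_m_perms[OF m \<alpha> this, THEN G_in_mFQSym_dual]
      then show ?thesis unfolding tensor_space_def by (intro fun_space.span_base) blast
    qed
    then have "Delta x \<in> ?T"
      unfolding x Delta_G[OF m \<alpha>] tensor_space_def by (rule fun_space.span_sum)
    moreover have "x \<in> WQSym" unfolding x by (rule G_in_WQSym[OF m \<alpha>])
    moreover have cx: "fscale c x \<in> WQSym"
      using calculation by (intro fun_space.subspace_scale[OF subspace_WQSym])
    ultimately have "Delta (fscale c x + y) = fscale c (Delta x) + Delta y"
      using step.IH by (simp only: Delta_add Delta_scale)
    also have "\<dots> \<in> ?T"
      using \<open>Delta x \<in> ?T\<close> step.IH unfolding tensor_space_def
      by (intro fun_space.span_add fun_space.span_scale) blast+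
    finally show ?case
      using fun_space.subspace_add[OF subspace_WQSym cx] step.IH by blast
  qed
  then show ?thesis ..
qed

text \<open>In the left antipode axiom for \<open>G m \<alpha>\<close> the cut \<open>k = n\<close>
  isolates the unknown; the other cuts have left factors of smaller degree, so the induction
  hypothesis and closure under products apply.\<close>

lemma antipode_G:
  assumes m: "m \<ge> 1" and S: "is_antipode S"
  shows "\<alpha> \<in> m_perms m n \<Longrightarrow> S (G m \<alpha>) \<in> (mFQSym_dual m :: 'k::field series set)"
proof (induction n arbitrary: \<alpha> rule: less_induct)
  case (less n)
  note \<alpha> = less.prems
  let ?l = "\<lambda>k. std m (restr \<alpha> {1..k})" and ?r = "\<lambda>k. std m (restr \<alpha> {k + 1..n})"
  have lin: "linear_on_WQSym S" using S by (simp add: is_antipode_def)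
  have lr: "?l k \<in> m_perms m k" "?r k \<in> m_perms m (n - k)" if "k \<in> {0..n}" for k
    using restr_std_in_m_perms[OF m \<alpha>] that by auto
  have last: "?l n = \<alpha>" "?r n = []"
  proof -
    have "restr \<alpha> {1..n} = \<alpha>" using \<alpha> by (auto simp: restr_def m_perms_def filter_id_conv)
    then show "?l n = \<alpha>" using std_m_perms[OF m \<alpha>] by simp
  qed (simp add: restr_def)
  have "G m \<alpha> \<in> (WQSym :: 'k series set)" by (rule G_in_WQSym[OF m \<alpha>])
  then have "fscale (counit (G m \<alpha>)) unit_series = convolution S id (G m \<alpha>)"
    using S by (simp add: is_antipode_def)
  also have "\<dots> = (\<Sum>k\<in>{0..n}. mult (S (G m (?l k))) (G m (?r k)))"
    unfolding convolution_def Delta_G[OF m \<alpha>]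
  proof -
    have "tensor_map S id (\<Sum>k\<in>{0..n}. tens (G m (?l k)) (G m (?r k))) =
        (\<Sum>k\<in>{0..n}. tens (S (G m (?l k))) (id (G m (?r k))))"
      by (intro tensor_map_sum_tens[OF lin linear_on_WQSym_id] conjI G_in_WQSym[OF m lr(1)] G_in_WQSym[OF m lr(2)])
        simp_all
    then show "mult2 (tensor_map S id (\<Sum>k\<in>{0..n}. tens (G m (?l k)) (G m (?r k)))) =
        (\<Sum>k\<in>{0..n}. mult (S (G m (?l k))) (G m (?r k)))"
      by (simp only: mult2_sum_tens id_apply)
  qed
  also have "\<dots> = S (G m \<alpha>) + (\<Sum>k\<in>{0..<n}. mult (S (G m (?l k))) (G m (?r k)))"
  proof -
    have "{0..n} = insert n {0..<n}" by auto
    then show ?thesis using last by (simp only: sum.insert finite_atLeastLessThan) (simp add: G_Nil mult_unit_right)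
  qed
  finally have "S (G m \<alpha>) = fscale (counit (G m \<alpha>)) unit_series -
      (\<Sum>k\<in>{0..<n}. mult (S (G m (?l k))) (G m (?r k)))"
    by (simp add: algebra_simps)
  moreover have "mult (S (G m (?l k))) (G m (?r k)) \<in> mFQSym_dual m" if "k \<in> {0..<n}" for k
    using that lr[of k] by (intro mult_mFQSym_dual m less.IH[of k] G_in_mFQSym_dual[of _ m "n - k"]) auto
  ultimately show ?case
    by (simp only:) (intro fun_space.subspace_diff fun_space.subspace_sum fun_space.subspace_scale
        subspace_mFQSym_dual unit_in_mFQSym_dual)
qed

lemma antipode_mFQSym_dual:
  assumes m: "m \<ge> 1" and S: "is_antipode S" and f: "f \<in> (mFQSym_dual m :: 'k::field series set)"
  shows "S f \<in> mFQSym_dual m"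
proof -
  have lin: "S (g + h) = S g + S h" "S (fscale c g) = fscale c (S g)" if "g \<in> WQSym" "h \<in> WQSym" for g h c
    using S that by (auto simp: is_antipode_def linear_on_WQSym_def)
  have W0: "(0 :: 'k series) \<in> WQSym" by (rule fun_space.subspace_0[OF subspace_WQSym])
  have "f \<in> WQSym \<and> S f \<in> mFQSym_dual m"
    using f[unfolded mFQSym_dual_def]
  proof (induction rule: fun_space.span_induct_alt)
    case base
    have "S 0 = 0" using lin(2)[OF W0 W0, of 0] by (simp add: fscale_def zero_fun_def)
    then show ?case using W0 by (metis fun_space.subspace_0 subspace_mFQSym_dual)
  next
    case (step c x y)
    then obtain \<alpha> n where x: "x = G m \<alpha>" and \<alpha>: "\<alpha> \<in> m_perms m n" by blast
    have xW: "x \<in> WQSym" "fscale c x \<in> WQSym"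
      unfolding x using G_in_WQSym[OF m \<alpha>] by (auto intro: fun_space.subspace_scale[OF subspace_WQSym])
    have "S (fscale c x + y) = fscale c (S x) + S y"
      using lin xW step.IH by simp
    moreover have "S x \<in> mFQSym_dual m" unfolding x by (rule antipode_G[OF m S \<alpha>])
    ultimately show ?case
      using step.IH fun_space.subspace_add[OF subspace_WQSym xW(2)]
      by (metis fun_space.subspace_add fun_space.subspace_scale subspace_mFQSym_dual)
  qed
  then show ?thesis ..
qed

theorem theorem4p5:
  fixes m :: nat
  assumes "m \<ge> 1"
  shows "hopf_subalgebra_of_WQSym (mFQSym_dual m :: 'k::field_char_0 series set) \<and>
    (\<forall>n p \<alpha> \<beta>. \<alpha> \<in> m_perms m n \<longrightarrow> \<beta> \<in> m_perms m p \<longrightarrow>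
       mult (G m \<alpha>) (G m \<beta>) = (\<Sum>\<gamma>\<in>star m \<alpha> \<beta>. G m \<gamma> :: 'k series)) \<and>
    (\<forall>n \<alpha>. \<alpha> \<in> m_perms m n \<longrightarrow>
       Delta (G m \<alpha>) = (\<Sum>k = 0..n.
         tens (G m (std m (restr \<alpha> {1..k}))) (G m (std m (restr \<alpha> {k + 1..n}))) :: 'k series2))"
proof (intro conjI allI impI)
  show "hopf_subalgebra_of_WQSym (mFQSym_dual m :: 'k series set)"
    unfolding hopf_subalgebra_of_WQSym_def
    using subspace_mFQSym_dual mFQSym_dual_subset_WQSym[OF assms] unit_in_mFQSym_dual mult_mFQSym_dual[OF assms]
      Delta_mFQSym_dual[OF assms] antipode_exists antipode_mFQSym_dual[OF assms]
    by (intro conjI ballI allI impI image_subsetI)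
qed (rule mult_G[OF assms], rule Delta_G[OF assms])

end
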